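(* Let $n\ge2$ and $m\ge1$ be integers. Let $\lambda=w\emptyset$ be an $n$-core, where $w$ is the minimal length left coset representative of $\widehat{\mathcal{S}}_n/\mathcal{S}_n$ with $w\emptyset=\lambda$, and let $\mathcal{A}=w^{-1}\mathcal{A}_0$ be the associated dominant alcove. Then $\mathcal{A}$ is $m$-minimal if and only if, for every residue $i\in\mathbb{Z}/n\mathbb{Z}$, whenever $\lambda$ has exactly $k$ removable boxes of residue $i$ then $k\le m$. In this case, $\lambda$ is also an $(mn+1)$-core.
   Context: Geometry. Let $\varepsilon_1,\dots,\varepsilon_n$ be the standard basis of $\mathbb{R}^n$ with the standard inner product $\langle\cdot\mid\cdot\rangle$, and $V=\{(a_1,\dots,a_n)\in\mathbb{R}^n\mid \sum_i a_i=0\}$. Put $\alpha_i=\varepsilon_i-\varepsilon_{i+1}$ for $1\le i\le n-1$, $\theta=\varepsilon_1-\varepsilon_n$ and $\Delta^+=\{\varepsilon_i-\varepsilon_j\mid i<j\}$. For a root $\alpha$ and $k\in\mathbb{Z}$ let $H_{\alpha,k}=\{v\in V\mid\langle v\mid\alpha\rangle=k\}$. The alcoves are the connected components of $V\setminus\bigcup_{\alpha\in\Delta^+,k\in\mathbb{Z}}H_{\alpha,k}$. The fundamental alcove is $\mathcal{A}_0=\{v\in V\mid \langle v\mid\alpha_i\rangle>0\ (1\le i\le n-1),\ \langle v\mid\theta\rangle<1\}$. An alcove is dominant if it lies in $\{v\in V\mid\langle v\mid\alpha_i\rangle\ge0,\ 1\le i\le n-1\}$. Group. The affine symmetric group $\widehat{\mathcal{S}}_n$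 is the Coxeter group generated by $s_0,s_1,\dots,s_{n-1}$ with $s_i^2=1$, $s_is_j=s_js_i$ if $i\not\equiv j\pm1 \bmod n$, $s_is_js_i=s_js_is_j$ if $i\equiv j\pm1\bmod n$ (for $n>2$; for $n=2$ only $s_i^2=1$). $\mathcal{S}_n$ is the subgroup generated by $s_1,\dots,s_{n-1}$, and $\ell$ is Coxeter length. It acts on $V$ by affine transformations: for $i\neq0$, $s_i$ swaps the $i$-th and $(i+1)$-st coordinates, and $s_0(a_1,\dots,a_n)=(a_n+1,a_2,\dots,a_{n-1},a_1-1)$. This action is free and transitive on alcoves. A minimal length left coset representative $w$ is the element of minimal length in $w\mathcal{S}_n$. $m$-minimal alcoves. The $m$-Shi arrangement is $\{H_{\alpha,k}\mid\alpha\in\Delta^+,\ -m<k\le m\}$; its regions are the connected components of the complement in $V$ of the union of these hyperplanes. Each region contains a unique alcove $w\mathcal{A}_0$ with $\ell(w)$ smallest among the alcoves in that region; such an alcove is called $m$-minimal. Cores. Partitions are identified with their Young diagrams $\{(i,j)\mid1\le j\le\lambda_i\}$. For a positive integer $t$, a partition is a $t$-core if none of its hook lengths is divisible by $t$. The residue of a box $(i,j)$ is $(j-i)\bmod n$; an $i$-box is a box of residue $i$. A box of $\lambda$ is removable if deleting it leaves a partition; a box not in $\lambda$ is addable if adding it gives a partition. An $n$-core never has both addable and removable $i$-boxes for the same $i$. $\widehat{\mathcal{S}}_n$ acts on the set of $n$-cores (transitively) by: $s_i\lambda$ is $\lambda$ with all addable $i$-boxes added if there is any addable $i$-box; $\lambda$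 with all removable $i$-boxes removed if there is any removable $i$-box; and $\lambda$ otherwise. $\emptyset$ denotes the empty partition; every $n$-core is $w\emptyset$ for a unique minimal length left coset representative $w$ of $\widehat{\mathcal{S}}_n/\mathcal{S}_n$. *)

theory Defs
  imports
    "HOL-Analysis.Analysis"
    "HOL-Algebra.Generated_Groups"
    "HOL-Number_Theory.Cong"
begin

section \<open>Geometry\<close>

text \<open>
  A vector \<open>(a\<^sub>1, \<dots>, a\<^sub>n)\<close> is a function on the naturals that vanishes outside \<open>{1..n}\<close>.  The
  topology is the product topology on \<^typ>\<open>nat \<Rightarrow> real\<close>; on these functions it is the usual
  topology of \<open>\<real>\<^sup>n\<close>, so that \<^const>\<open>components\<close> yields connected components in the usual sense.
\<close>

type_synonym vec = "nat \<Rightarrow> real"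

definition hyperspace :: "nat \<Rightarrow> vec set" where
  "hyperspace n = {v. (\<forall>i. i \<notin> {1..n} \<longrightarrow> v i = 0) \<and> (\<Sum>i=1..n. v i) = 0}"

definition ip :: "nat \<Rightarrow> vec \<Rightarrow> vec \<Rightarrow> real" where
  "ip n v w = (\<Sum>i=1..n. v i * w i)"

definition eps :: "nat \<Rightarrow> vec" where
  "eps i = (\<lambda>k. if k = i then 1 else 0)"

definition root_vec :: "nat \<Rightarrow> nat \<Rightarrow> vec" where
  "root_vec i j = (\<lambda>k. eps i k - eps j k)"

definition simple_root :: "nat \<Rightarrow> vec" where
  "simple_root i = root_vec i (i + 1)"

definition highest_root :: "nat \<Rightarrow> vec" where
  "highest_root n = root_vec 1 n"

definition pos_roots :: "nat \<Rightarrow> vec set" where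
  "pos_roots n = {root_vec i j | i j. 1 \<le> i \<and> i < j \<and> j \<le> n}"

definition hyp :: "nat \<Rightarrow> vec \<Rightarrow> int \<Rightarrow> vec set" where
  "hyp n \<alpha> k = {v \<in> hyperspace n. ip n v \<alpha> = of_int k}"

definition alcoves :: "nat \<Rightarrow> vec set set" where
  "alcoves n = components (hyperspace n - (\<Union>\<alpha>\<in>pos_roots n. \<Union>k. hyp n \<alpha> k))"

definition fundamental_alcove :: "nat \<Rightarrow> vec set" where
  "fundamental_alcove n =
     {v \<in> hyperspace n. (\<forall>i\<in>{1..n-1}. ip n v (simple_root i) > 0) \<and> ip n v (highest_root n) < 1}"

definition shi_regions :: "nat \<Rightarrow> nat \<Rightarrow> vec set set" where
  "shi_regions n m =
     components (hyperspace n - (\<Union>\<alpha>\<in>pos_roots n. \<Union>k\<in>{- int m<..int m}. hyp n \<alpha> k))"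


section \<open>The affine symmetric group\<close>

definition adjacent :: "nat \<Rightarrow> nat \<Rightarrow> nat \<Rightarrow> bool" where
  "adjacent n i j \<longleftrightarrow> [int i = int j + 1] (mod int n) \<or> [int i = int j - 1] (mod int n)"

text \<open>
  The group is given by its Coxeter presentation: words in the letters \<open>0, \<dots>, n - 1\<close> modulo the
  congruence generated by the defining relations.  The word \<open>[i\<^sub>1, \<dots>, i\<^sub>k]\<close> stands for
  \<open>s\<^bsub>i\<^sub>1\<^esub> \<cdots> s\<^bsub>i\<^sub>k\<^esub>\<close>.  Since the generators are involutions, no letters for inverses are needed.
\<close>

inductive coxeter_relation :: "nat \<Rightarrow> nat list \<Rightarrow> nat list \<Rightarrow> bool" for n where
  square: "i < n \<Longrightarrow> coxeter_relation n [i, i] []"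
| commute: "\<lbrakk>n > 2; i < n; j < n; \<not> adjacent n i j\<rbrakk> \<Longrightarrow> coxeter_relation n [i, j] [j, i]"
| braid: "\<lbrakk>n > 2; i < n; j < n; adjacent n i j\<rbrakk> \<Longrightarrow> coxeter_relation n [i, j, i] [j, i, j]"

inductive word_eq :: "nat \<Rightarrow> nat list \<Rightarrow> nat list \<Rightarrow> bool" for n where
  word_refl: "xs \<in> lists {..<n} \<Longrightarrow> word_eq n xs xs"
| word_sym: "word_eq n xs ys \<Longrightarrow> word_eq n ys xs"
| word_trans: "\<lbrakk>word_eq n xs ys; word_eq n ys zs\<rbrakk> \<Longrightarrow> word_eq n xs zs"
| word_step: "\<lbrakk>coxeter_relation n xs ys; us \<in> lists {..<n}; vs \<in> lists {..<n}\<rbrakk>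
    \<Longrightarrow> word_eq n (us @ xs @ vs) (us @ ys @ vs)"

definition word_rel :: "nat \<Rightarrow> (nat list \<times> nat list) set" where
  "word_rel n = {(xs, ys). word_eq n xs ys}"

definition affine_sym :: "nat \<Rightarrow> nat list set monoid" where
  "affine_sym n =
     \<lparr>carrier = lists {..<n} // word_rel n,
      mult = (\<lambda>X Y. \<Union>xs\<in>X. \<Union>ys\<in>Y. word_rel n `` {xs @ ys}),
      one = word_rel n `` {[]}\<rparr>"

definition sgen :: "nat \<Rightarrow> nat \<Rightarrow> nat list set" where
  "sgen n i = word_rel n `` {[i]}"

definition finite_sym :: "nat \<Rightarrow> nat list set set" where
  "finite_sym n = generate (affine_sym n) (sgen n ` {1..<n})"

text \<open>
  As a set, a group element consists of all words that represent it.
\<close>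

definition cox_length :: "nat list set \<Rightarrow> nat" where
  "cox_length w = (LEAST k. \<exists>xs\<in>w. length xs = k)"

definition min_left_coset_rep :: "nat \<Rightarrow> nat list set \<Rightarrow> bool" where
  "min_left_coset_rep n w \<longleftrightarrow> w \<in> carrier (affine_sym n) \<and>
     is_arg_min cox_length (\<lambda>u. u \<in> w <#\<^bsub>affine_sym n\<^esub> finite_sym n) w"

text \<open>
  The action of a group element determined by an action \<open>f\<close> of the generators: the common value
  of \<open>f i\<^sub>1 (\<cdots> (f i\<^sub>k x))\<close> over all words \<open>[i\<^sub>1, \<dots>, i\<^sub>k]\<close> that represent the element.
\<close>

definition word_act :: "(nat \<Rightarrow> 'a \<Rightarrow> 'a) \<Rightarrow> nat list set \<Rightarrow> 'a \<Rightarrow> 'a" where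
  "word_act f w x = the_elem ((\<lambda>xs. foldr f xs x) ` w)"

definition vec_refl :: "nat \<Rightarrow> nat \<Rightarrow> vec \<Rightarrow> vec" where
  "vec_refl n i v =
     (if i = 0 then v(1 := v n + 1, n := v 1 - 1) else v(i := v (i + 1), i + 1 := v i))"

definition alcove_of :: "nat \<Rightarrow> nat list set \<Rightarrow> vec set" where
  "alcove_of n w = word_act (vec_refl n) w ` fundamental_alcove n"

definition m_minimal :: "nat \<Rightarrow> nat \<Rightarrow> vec set \<Rightarrow> bool" where
  "m_minimal n m A \<longleftrightarrow> A \<in> alcoves n \<and>
     (\<exists>R\<in>shi_regions n m. \<exists>w.
        A = alcove_of n w \<and>
        is_arg_min cox_length (\<lambda>u. u \<in> carrier (affine_sym n) \<and> alcove_of n u \<subseteq> R) w)"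


section \<open>Cores\<close>

text \<open>
  A partition is its Young diagram, a set of boxes \<open>(i, j)\<close> (row, column), both counted from 1.
\<close>

type_synonym diagram = "(nat \<times> nat) set"

definition young_diagram :: "nat list \<Rightarrow> diagram" where
  "young_diagram p = {(i, j). 1 \<le> i \<and> i \<le> length p \<and> 1 \<le> j \<and> j \<le> p ! (i - 1)}"

definition is_partition :: "diagram \<Rightarrow> bool" where
  "is_partition D \<longleftrightarrow>
     (\<exists>p. sorted_wrt (\<ge>) p \<and> (\<forall>x\<in>set p. x > 0) \<and> D = young_diagram p)"

definition hook_length :: "diagram \<Rightarrow> nat \<times> nat \<Rightarrow> nat" where
  "hook_length D b = card {(i, j) \<in> D. i = fst b \<and> j \<ge> snd b \<or> j = snd b \<and> i \<ge> fst b}"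

definition is_core :: "nat \<Rightarrow> diagram \<Rightarrow> bool" where
  "is_core t D \<longleftrightarrow> is_partition D \<and> (\<forall>b\<in>D. \<not> t dvd hook_length D b)"

definition residue :: "nat \<Rightarrow> nat \<times> nat \<Rightarrow> int" where
  "residue n b = (int (snd b) - int (fst b)) mod int n"

definition removable_boxes :: "nat \<Rightarrow> diagram \<Rightarrow> int \<Rightarrow> diagram" where
  "removable_boxes n D i = {b \<in> D. is_partition (D - {b}) \<and> residue n b = i}"

definition addable_boxes :: "nat \<Rightarrow> diagram \<Rightarrow> int \<Rightarrow> diagram" where
  "addable_boxes n D i = {b. b \<notin> D \<and> is_partition (insert b D) \<and> residue n b = i}"

definition core_refl :: "nat \<Rightarrow> nat \<Rightarrow> diagram \<Rightarrow> diagram" where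
  "core_refl n i D =
     (if addable_boxes n D (int i) \<noteq> {} then D \<union> addable_boxes n D (int i)
      else if removable_boxes n D (int i) \<noteq> {} then D - removable_boxes n D (int i)
      else D)"


section \<open>Well-definedness\<close>

lemma coxeter_relation_lists:
  "coxeter_relation n xs ys \<Longrightarrow> xs \<in> lists {..<n} \<and> ys \<in> lists {..<n}"
  by (induction rule: coxeter_relation.induct) auto

lemma word_eq_lists: "word_eq n xs ys \<Longrightarrow> xs \<in> lists {..<n} \<and> ys \<in> lists {..<n}"
  by (induction rule: word_eq.induct) (use coxeter_relation_lists in fastforce)+

lemma equiv_word_rel: "equiv (lists {..<n}) (word_rel n)"
proof (rule equivI)
  show "word_rel n \<subseteq> lists {..<n} \<times> lists {..<n}"
    using word_eq_lists by (fastforce simp: word_rel_def)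
  show "refl_on (lists {..<n}) (word_rel n)"
    by (rule refl_onI) (simp add: word_rel_def word_refl)
  show "sym (word_rel n)"
    by (rule symI) (simp add: word_rel_def word_sym)
  show "trans (word_rel n)"
    by (rule transI) (simp add: word_rel_def, blast intro: word_trans)
qed

lemma word_eq_append_left:
  assumes "word_eq n xs ys" "us \<in> lists {..<n}"
  shows "word_eq n (us @ xs) (us @ ys)"
  using assms
proof (induction rule: word_eq.induct)
  case (word_step xs ys vs ws)
  then show ?case
    using word_eq.word_step[of n xs ys "us @ vs" ws] by simp
next
  case (word_refl xs)
  then show ?case by (intro word_eq.word_refl) auto
qed (auto intro: word_sym word_trans)

lemma word_eq_append_right:
  assumes "word_eq n xs ys" "us \<in> lists {..<n}"
  shows "word_eq n (xs @ us) (ys @ us)"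
  using assms
proof (induction rule: word_eq.induct)
  case (word_step xs ys vs ws)
  then show ?case
    using word_eq.word_step[of n xs ys vs "ws @ us"] by simp
next
  case (word_refl xs)
  then show ?case by (intro word_eq.word_refl) auto
qed (auto intro: word_sym word_trans)

lemma word_eq_append:
  assumes "word_eq n xs xs'" "word_eq n ys ys'"
  shows "word_eq n (xs @ ys) (xs' @ ys')"
  using assms word_eq_append_left word_eq_append_right word_eq_lists word_trans by metis

lemma congruent2_append:
  "congruent2 (word_rel n) (word_rel n) (\<lambda>xs ys. word_rel n `` {xs @ ys})"
proof (rule congruent2I')
  fix xs xs' ys ys'
  assume "(xs, xs') \<in> word_rel n" "(ys, ys') \<in> word_rel n"
  then have "(xs @ ys, xs' @ ys') \<in> word_rel n"
    by (simp add: word_rel_def word_eq_append)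
  then show "word_rel n `` {xs @ ys} = word_rel n `` {xs' @ ys'}"
    by (rule equiv_class_eq[OF equiv_word_rel])
qed

lemma affine_sym_mult_class:
  assumes "xs \<in> lists {..<n}" "ys \<in> lists {..<n}"
  shows "word_rel n `` {xs} \<otimes>\<^bsub>affine_sym n\<^esub> word_rel n `` {ys} = word_rel n `` {xs @ ys}"
  unfolding affine_sym_def
  using UN_equiv_class2[OF equiv_word_rel equiv_word_rel congruent2_append assms] by simp

lemma word_eq_rev_append: "xs \<in> lists {..<n} \<Longrightarrow> word_eq n (rev xs @ xs) []"
proof (induction xs)
  case Nil
  then show ?case by (simp add: word_refl)
next
  case (Cons x xs)
  then have "word_eq n (rev xs @ [x, x] @ xs) (rev xs @ [] @ xs)"
    by (intro word_step square) (auto simp: in_lists_conv_set)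
  with Cons show ?case
    by (auto intro: word_trans)
qed

lemma group_affine_sym: "group (affine_sym n)"
proof (rule groupI)
  have carr: "\<exists>xs\<in>lists {..<n}. x = word_rel n `` {xs}" if "x \<in> carrier (affine_sym n)" for x
    using that by (auto simp: affine_sym_def elim: quotientE)
  have class_in: "word_rel n `` {xs} \<in> carrier (affine_sym n)" if "xs \<in> lists {..<n}" for xs
    using that by (auto simp: affine_sym_def intro: quotientI)
  have one: "\<one>\<^bsub>affine_sym n\<^esub> = word_rel n `` {[]}"
    by (simp add: affine_sym_def)
  note mult = affine_sym_mult_class
  show "\<one>\<^bsub>affine_sym n\<^esub> \<in> carrier (affine_sym n)"
    by (simp add: one class_in)
  fix x assume "x \<in> carrier (affine_sym n)"
  then obtain xs where xs: "xs \<in> lists {..<n}" "x = word_rel n `` {xs}"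
    using carr by blast
  show "\<one>\<^bsub>affine_sym n\<^esub> \<otimes>\<^bsub>affine_sym n\<^esub> x = x"
    using mult[of "[]" n xs] xs by (simp add: one)
  have rev: "rev xs \<in> lists {..<n}"
    using xs by (auto simp: in_lists_conv_set)
  have "(rev xs @ xs, []) \<in> word_rel n"
    using word_eq_rev_append[OF xs(1)] by (simp add: word_rel_def)
  then have "word_rel n `` {rev xs} \<otimes>\<^bsub>affine_sym n\<^esub> x = \<one>\<^bsub>affine_sym n\<^esub>"
    using equiv_class_eq[OF equiv_word_rel] mult[OF rev xs(1)] xs(2) one by simp
  then show "\<exists>y\<in>carrier (affine_sym n). y \<otimes>\<^bsub>affine_sym n\<^esub> x = \<one>\<^bsub>affine_sym n\<^esub>"
    using class_in[OF rev] by blast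
  fix y assume "y \<in> carrier (affine_sym n)"
  then obtain ys where ys: "ys \<in> lists {..<n}" "y = word_rel n `` {ys}"
    using carr by blast
  show "x \<otimes>\<^bsub>affine_sym n\<^esub> y \<in> carrier (affine_sym n)"
    using mult[OF xs(1) ys(1)] class_in[of "xs @ ys"] xs ys by simp
  fix z assume "z \<in> carrier (affine_sym n)"
  then obtain zs where zs: "zs \<in> lists {..<n}" "z = word_rel n `` {zs}"
    using carr by blast
  show "x \<otimes>\<^bsub>affine_sym n\<^esub> y \<otimes>\<^bsub>affine_sym n\<^esub> z = x \<otimes>\<^bsub>affine_sym n\<^esub> (y \<otimes>\<^bsub>affine_sym n\<^esub> z)"
    using mult[of "xs @ ys" n zs] mult[of xs n "ys @ zs"] mult[of xs n ys] mult[of ys n zs]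
      xs ys zs by simp
qed

lemma adjacent_cases:
  assumes "i < n" "j < n" "adjacent n i j"
  shows "i = Suc j \<or> j = Suc i \<or> i = 0 \<and> Suc j = n \<or> j = 0 \<and> Suc i = n"
proof -
  have *: "b = Suc a \<or> b = 0 \<and> Suc a = n"
    if "a < n" "b < n" "[int b = int a + 1] (mod int n)" for a b
  proof (cases "Suc a = n")
    case True
    with that have "int b mod int n = 0"
      by (simp add: cong_def) (metis mod_self of_nat_Suc add.commute)
    with that True show ?thesis by simp
  next
    case False
    with that have "int a + 1 < int n" by linarith
    with that show ?thesis by (simp add: cong_def)
  qed
  have "[int j = int i + 1] (mod int n)" if "[int i = int j - 1] (mod int n)"
    using cong_add[OF that cong_refl[of 1]] by (simp add: cong_sym)
  with *[of i j] *[of j i] assms show ?thesis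
    unfolding adjacent_def by blast
qed

lemma adjacent_Suc: "adjacent n (Suc i) i" "adjacent n i (Suc i)"
  by (simp_all add: adjacent_def cong_iff_dvd_diff)

lemma adjacent_wrap: "adjacent (Suc i) i 0" "adjacent (Suc i) 0 i"
proof -
  have "int i + 1 = int (Suc i)" "- int i - 1 = - int (Suc i)"
    by simp_all
  then have "int (Suc i) dvd int i + 1" "int (Suc i) dvd - int i - 1"
    by (metis dvd_refl dvd_minus_iff)+
  then show "adjacent (Suc i) i 0" "adjacent (Suc i) 0 i"
    unfolding adjacent_def cong_iff_dvd_diff by simp_all
qed

lemma vec_refl_relation:
  assumes "coxeter_relation n xs ys" "n \<ge> 2"
  shows "foldr (vec_refl n) xs v = foldr (vec_refl n) ys v"
  using assms
proof (cases rule: coxeter_relation.cases)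
  case (square i)
  with assms(2) show ?thesis by (auto simp: vec_refl_def fun_eq_iff)
next
  case (commute i j)
  then have "i \<noteq> Suc j" "j \<noteq> Suc i" "\<not> (i = 0 \<and> Suc j = n)" "\<not> (j = 0 \<and> Suc i = n)"
    using adjacent_Suc adjacent_wrap by blast+
  with commute show ?thesis by (auto simp: vec_refl_def fun_eq_iff)
next
  case (braid i j)
  then consider "i = Suc j" | "j = Suc i" | "i = 0" "n = Suc j" | "j = 0" "n = Suc i"
    using adjacent_cases[of i n j] by blast
  then show ?thesis
    using braid by cases (cases i; cases j; auto simp: vec_refl_def fun_eq_iff)+
qed

lemma vec_refl_word_eq:
  assumes "word_eq n xs ys" "n \<ge> 2"
  shows "foldr (vec_refl n) xs v = foldr (vec_refl n) ys v"
  using assms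
proof (induction arbitrary: v rule: word_eq.induct)
  case (word_step xs ys us vs)
  then show ?case by (simp add: vec_refl_relation)
qed simp_all

end

theory Submission
  imports Defs
begin

text \<open>
  Both sides of the equivalence are read off from one integral vector, the charge
  \<open>c = w 0 \<in> \<int>\<^sup>n\<close>.  Extend a vector \<open>v\<close> to all integers by \<open>v (k + n) = v k - 1\<close>; then every
  generator, including the affine one, merely exchanges the entries at neighbouring
  indices (\<open>ext_vec_refl\<close>).  Write \<open>d\<^sub>i = c (i + 1) - c i\<close> for the steps of the extended charge.

  On the core side, place a bead at \<open>\<lambda>\<^sub>i - i + 1\<close> for every row \<open>i \<ge> 1\<close> of \<open>\<lambda> = w \<emptyset>\<close>.  The set of
  beads is \<open>{k. c k > 0}\<close>, because adding or removing all boxes of residue \<open>i\<close> exchanges the runners \<open>i\<close> and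
  \<open>i + 1\<close> of the abacus (\<open>core_refl_beads\<close>).  A removable box of residue \<open>i\<close> is a bead
  at \<open>i + 1\<close> modulo \<open>n\<close> with a gap just below it, so there are \<open>max 0 d\<^sub>i\<close> of them
  (\<open>card_removable\<close>).  Hook lengths are differences between a bead and a smaller gap; if all
  \<open>d\<^sub>i \<le> m\<close>, moving a bead down by \<open>m n + 1\<close> never meets a gap, and \<open>w \<emptyset>\<close> is an
  \<open>(m n + 1)\<close>-core.

  On the alcove side, a word acts by a permutation of the coordinates and an integral
  translation (\<open>word_affine\<close>), so the alcove \<open>w\<^sup>-\<^sup>1 A\<^sub>0\<close> contains a point \<open>x\<close> whose coordinates are
  those of a base point minus the charge, permuted.  If \<open>k\<close> and \<open>k + 1\<close> are the residues of the
  coordinates \<open>a\<close> and \<open>b\<close>, then \<open>x a - x b = 1 / n + d\<^sub>k\<close>: the walls of the alcove lie at the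
  levels \<open>d\<^sub>k\<close>.  If some \<open>d\<^sub>k > m\<close>, the reflection in this wall stays in the same region of the
  \<open>m\<close>-Shi arrangement and crosses one hyperplane less (\<open>shorter_neighbour\<close>).  If all \<open>d\<^sub>k \<le> m\<close>,
  every other alcove of the region lies beyond at least as many hyperplanes
  (\<open>dominant_floor_le\<close>): a large difference \<open>x a - x b\<close> can be split at an intermediate
  coordinate, since the sequence of coordinates in the order of their residues can only descend
  in small steps.

  Both arguments count hyperplanes, whereas minimality refers to the length in the Coxeter
  presentation.  The bridge is the exchange property of words (\<open>exchange\<close>), which gives
  \<open>cox_length_separation\<close>, and also shows that a minimal coset representative yields a dominant
  alcove (\<open>min_rep_dominant\<close>).
\<close>

section \<open>The periodic extension of a vector\<close>

text \<open>
  With the period shift \<open>-1\<close>, the affine generator becomes a transposition of neighbours like all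
  others, which removes the case distinction between \<open>s\<^sub>0\<close> and \<open>s\<^sub>i\<close>.
\<close>

definition ext :: "nat \<Rightarrow> (nat \<Rightarrow> 'a::ring_1) \<Rightarrow> int \<Rightarrow> 'a" where
  "ext n v k = v (nat ((k - 1) mod int n) + 1) - of_int ((k - 1) div int n)"

definition letter :: "nat \<Rightarrow> int \<Rightarrow> nat" where
  "letter n k = nat (k mod int n)"

lemma ext_nat: "1 \<le> a \<Longrightarrow> a \<le> n \<Longrightarrow> ext n v (int a) = v a"
  by (simp add: ext_def nat_diff_distrib)

lemma ext_shift:
  assumes "n > 0"
  shows "ext n v (k + int n * t) = ext n v k - of_int t"
proof -
  have "k + int n * t - 1 = (k - 1) + int n * t" by simp
  moreover have "((k - 1) + int n * t) div int n = (k - 1) div int n + t"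
    using assms by simp
  moreover have "((k - 1) + int n * t) mod int n = (k - 1) mod int n"
    by simp
  ultimately show ?thesis unfolding ext_def by (simp only: of_int_add diff_diff_eq)
qed

lemma ext_zero: "n > 0 \<Longrightarrow> ext n v 0 = v n + 1"
  using ext_shift[of n v "int n" "- 1"] ext_nat[of n n v] by simp

lemma ext_Suc_n: "n > 0 \<Longrightarrow> ext n v (int n + 1) = v 1 - 1"
  using ext_shift[of n v "1" "1"] ext_nat[of 1 n v] by (simp add: add.commute)

lemma ext_of_int: "ext n (\<lambda>a. of_int (c a)) k = of_int (ext n c k)"
  by (simp add: ext_def)

lemma int_as_window:
  assumes "n > 0"
  obtains a t where "1 \<le> a" "a \<le> n" "k = int a + int n * t"
proof
  let ?a = "nat ((k - 1) mod int n) + 1"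
  show "1 \<le> ?a" by simp
  have "(k - 1) mod int n < int n" "0 \<le> (k - 1) mod int n" using assms by simp_all
  then show "?a \<le> n" by linarith
  have "int ?a = (k - 1) mod int n + 1" using \<open>0 \<le> (k - 1) mod int n\<close> by simp
  moreover have "k - 1 = (k - 1) mod int n + int n * ((k - 1) div int n)"
    by simp
  ultimately show "k = int ?a + int n * ((k - 1) div int n)" by linarith
qed

lemma letter_less: "n > 0 \<Longrightarrow> letter n k < n"
  unfolding letter_def by (simp add: nat_less_iff)

lemma int_letter: "n > 0 \<Longrightarrow> int (letter n k) = k mod int n"
  unfolding letter_def by simp

lemma letter_nat: "i < n \<Longrightarrow> letter n (int i) = i"
  unfolding letter_def by simp

definition idx_refl :: "nat \<Rightarrow> int \<Rightarrow> int \<Rightarrow> int" where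
  "idx_refl n i k = (if [k = i] (mod int n) then k + 1 else if [k = i + 1] (mod int n) then k - 1 else k)"

lemma idx_refl_simps:
  assumes "n \<ge> 2"
  shows "idx_refl n i i = i + 1" "idx_refl n i (i + 1) = i"
proof -
  have "\<not> [i + 1 = i] (mod int n)"
    using assms zdvd_imp_le[of "int n" 1] by (auto simp: cong_iff_dvd_diff)
  then show "idx_refl n i i = i + 1" "idx_refl n i (i + 1) = i"
    by (simp_all add: idx_refl_def)
qed

lemma idx_refl_other:
  "\<not> [k = i] (mod int n) \<Longrightarrow> \<not> [k = i + 1] (mod int n) \<Longrightarrow> idx_refl n i k = k"
  by (simp add: idx_refl_def)

lemma idx_refl_shift: "idx_refl n i (k + int n * t) = idx_refl n i k + int n * t"
  by (simp add: idx_refl_def cong_def)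

lemma ext_vec_refl:
  assumes n: "n \<ge> 2" and i: "i < n"
  shows "ext n (vec_refl n i v) k = ext n v (idx_refl n (int i) k)"
proof -
  have n0: "n > 0" using n by simp
  obtain a t where a: "1 \<le> a" "a \<le> n" and k: "k = int a + int n * t"
    using int_as_window[OF n0] .
  have cg: "[int x = int y] (mod int n) \<longleftrightarrow> x = y" if "x < n" "y < n" for x y
    using that by (simp add: cong_def)
  have an: "[int a = int y] (mod int n) \<longleftrightarrow> a = y \<or> a = n \<and> y = 0" if "y \<le> n" "y < n" for y
  proof (cases "a = n")
    case True then show ?thesis using that n0 by (auto simp: cong_def)
  next
    case False then show ?thesis using that a cg[of a y] by auto
  qed
  have an1: "[int a = int i + 1] (mod int n) \<longleftrightarrow> a = i + 1"
  proof (cases "i + 1 = n")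
    case True
    then have c: "int i + 1 = int n" by simp
    have "[int a = int n] (mod int n) \<longleftrightarrow> a = n"
      using a by (cases "a = n") (auto simp: cong_def)
    then show ?thesis unfolding c using True by simp
  next
    case False
    then show ?thesis using an[of "i + 1"] i by (auto simp: add.commute)
  qed
  have "ext n (vec_refl n i v) (int a) = ext n v (idx_refl n (int i) (int a))"
  proof (cases "i = 0")
    case True
    have "n \<noteq> 1" using n by simp
    then show ?thesis
      using True a an[of 0] an1 n0 ext_nat[OF a, of "vec_refl n i v"] ext_nat[OF a, of v]
        ext_zero[OF n0, of v] ext_Suc_n[OF n0, of v]
      by (auto simp: idx_refl_def vec_refl_def)
  next
    case False
    then have "ext n v (int i + 1) = v (i + 1)"
      using i ext_nat[of "i + 1" n v] by (simp add: add.commute)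
    then show ?thesis
      using False a i an[of i] an1 n0 ext_nat[OF a, of "vec_refl n i v"] ext_nat[OF a, of v]
        ext_nat[of i n v]
      by (auto simp: idx_refl_def vec_refl_def)
  qed
  then show ?thesis
    unfolding k idx_refl_shift ext_shift[OF n0] by simp
qed

lemma idx_refl_cong:
  assumes "[i = j] (mod int n)" shows "idx_refl n i k = idx_refl n j k"
proof -
  have "[i + 1 = j + 1] (mod int n)" using assms by (simp add: cong_add)
  with assms have "[k = i] (mod int n) \<longleftrightarrow> [k = j] (mod int n)"
    "[k = i + 1] (mod int n) \<longleftrightarrow> [k = j + 1] (mod int n)"
    by (auto simp: cong_def)
  then show ?thesis by (simp add: idx_refl_def)
qed

lemma ext_vec_refl_letter:
  assumes n: "n \<ge> 2"
  shows "ext n (vec_refl n (letter n i) v) k = ext n v (idx_refl n i k)"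
proof -
  have n0: "n > 0" using n by simp
  have "[int (letter n i) = i] (mod int n)" by (simp add: int_letter[OF n0] cong_def)
  from idx_refl_cong[OF this] show ?thesis
    using ext_vec_refl[OF n letter_less[OF n0], of i v k] by simp
qed

lemma vec_refl_involution:
  assumes n: "n \<ge> 2" and i: "i < n"
  shows "vec_refl n i (vec_refl n i v) = v"
  using vec_refl_relation[OF square[OF i] n, of v] by simp

section \<open>Words as affine maps\<close>

text \<open>
  The translation part \<open>c\<close> is the image of the origin; it determines both the core and the alcove.
  The formula holds for all vectors, not only in the hyperplane, so that it can be evaluated at the
  origin and inverted.
\<close>
lemma word_affine:
  assumes n: "n \<ge> 2" and "xs \<in> lists {..<n}"
  shows "\<exists>c \<pi>. \<pi> permutes {1..n} \<and> (\<forall>a. a \<notin> {1..n} \<longrightarrow> c a = 0) \<and> (\<Sum>a=1..n. c a) = 0 \<and>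
     (\<forall>p. foldr (vec_refl n) xs p = (\<lambda>a. p (\<pi> a) + of_int (c a)))"
  using assms(2)
proof (induction xs)
  case Nil
  show ?case by (rule exI[of _ "\<lambda>_. 0"], rule exI[of _ id]) (auto simp: permutes_def)
next
  case (Cons i xs)
  then obtain c \<pi> where IH: "\<pi> permutes {1..n}" "\<forall>a. a \<notin> {1..n} \<longrightarrow> c a = 0"
      "(\<Sum>a=1..n. c a) = 0" "\<And>p. foldr (vec_refl n) xs p = (\<lambda>a. p (\<pi> a) + of_int (c a))"
    by blast
  have i: "i < n" using Cons by simp
  let ?e = "if i = 0 then n else i" and ?e' = "i + 1"
  let ?\<tau> = "Transposition.transpose ?e ?e'"
  let ?z = "(if i = 0 then 1 else 0) :: int"
  let ?c = "\<lambda>a. c (?\<tau> a) + (if a = ?e' then ?z else 0) - (if a = ?e then ?z else 0)"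
  have ee: "?e \<in> {1..n}" "?e' \<in> {1..n}" "?e \<noteq> ?e'" using n i by auto
  have \<tau>: "?\<tau> permutes {1..n}" using permutes_swap_id[OF ee(1,2)] .
  have "(\<Sum>a=1..n. c (?\<tau> a)) = (\<Sum>a=1..n. c a)"
    using sum.permute[OF \<tau>, of c] by (simp add: comp_def)
  then have "(\<Sum>a=1..n. ?c a) = 0"
    using IH(3) ee by (simp add: sum.distrib sum_subtractf)
  moreover have "?c a = 0" if "a \<notin> {1..n}" for a
  proof -
    have "a \<noteq> ?e" "a \<noteq> ?e'" using that ee by metis+
    moreover from this have "?\<tau> a = a" by (simp add: Transposition.transpose_def)
    ultimately show ?thesis using IH(2) that by simp
  qed
  moreover have "(\<pi> \<circ> ?\<tau>) permutes {1..n}" using permutes_compose[OF \<tau> IH(1)] .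
  moreover have "foldr (vec_refl n) (i # xs) p = (\<lambda>a. p ((\<pi> \<circ> ?\<tau>) a) + of_int (?c a))" for p
    using n i by (auto simp: IH(4) vec_refl_def fun_eq_iff Transposition.transpose_def)
  ultimately show ?case by (intro exI[of _ ?c] exI[of _ "\<pi> \<circ> ?\<tau>"]) blast
qed

lemma foldr_rev_cancel:
  assumes n: "n \<ge> 2" and "xs \<in> lists {..<n}"
  shows "foldr (vec_refl n) (rev xs) (foldr (vec_refl n) xs p) = p"
  using vec_refl_word_eq[OF word_eq_rev_append[OF assms(2)] n, of p] by simp

lemma rev_in_lists: "xs \<in> lists A \<Longrightarrow> rev xs \<in> lists A"
  by (auto simp: in_lists_conv_set)

lemma word_affine_rev:
  fixes c :: "nat \<Rightarrow> int"
  assumes n: "n \<ge> 2" and xs: "xs \<in> lists {..<n}" and perm: "\<pi> permutes {1..n}"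
    and eq: "\<And>p. foldr (vec_refl n) xs p = (\<lambda>a. p (\<pi> a) + of_int (c a))"
  shows "foldr (vec_refl n) (rev xs) p = (\<lambda>a. p (inv_into UNIV \<pi> a) - of_int (c (inv_into UNIV \<pi> a)))"
proof -
  let ?q = "\<lambda>a. p (inv_into UNIV \<pi> a) - of_int (c (inv_into UNIV \<pi> a))"
  have "foldr (vec_refl n) xs ?q = p"
    using permutes_inverses[OF perm] by (simp add: eq)
  with foldr_rev_cancel[OF n xs, of ?q] show ?thesis by simp
qed

lemma foldr_hyperspace:
  assumes n: "n \<ge> 2" and "xs \<in> lists {..<n}" and p: "p \<in> hyperspace n"
  shows "foldr (vec_refl n) xs p \<in> hyperspace n"
proof -
  obtain c \<pi> where c: "\<pi> permutes {1..n}" "\<forall>a. a \<notin> {1..n} \<longrightarrow> c a = 0"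
      "(\<Sum>a=1..n. c a) = 0" "\<And>p. foldr (vec_refl n) xs p = (\<lambda>a. p (\<pi> a) + of_int (c a))"
    using word_affine[OF assms(1,2)] by blast
  have "(\<Sum>a=1..n. p (\<pi> a)) = (\<Sum>a=1..n. p a)"
    using sum.permute[OF c(1), of p] by (simp add: comp_def)
  moreover have "(\<Sum>a=1..n. real_of_int (c a)) = 0" using c(3) by (metis of_int_sum of_int_0)
  moreover have "\<pi> a = a" if "a \<notin> {1..n}" for a using c(1) that by (rule permutes_not_in)
  ultimately show ?thesis
    using p c(2) by (auto simp: hyperspace_def c(4) sum.distrib)
qed

section \<open>Exchange in the presented group\<close>

lemma not_cong_plus:
  assumes "0 < d" "d < int n"
  shows "\<not> [k + d = k] (mod int n)" "\<not> [k = k + d] (mod int n)" "\<not> [k - d = k] (mod int n)" "\<not> [k = k - d] (mod int n)"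
  using assms zdvd_imp_le[of "int n" d] by (auto simp: cong_iff_dvd_diff)

lemma word_eq_Cons:
  "word_eq n xs ys \<Longrightarrow> i < n \<Longrightarrow> word_eq n (i # xs) (i # ys)"
  using word_eq_append_left[of n xs ys "[i]"] by simp

lemma word_eq_cancel:
  assumes "i < n" "xs \<in> lists {..<n}" shows "word_eq n (i # i # xs) xs"
  using word_step[OF square[OF assms(1)], of "[]" xs] assms(2) by simp

text \<open>
  A geometric descent can be split off as the first letter in the presented group.  No faithfulness
  of the action is presupposed: the proof inducts on the length of the word and compares the first
  letter \<open>j\<close> with the letter \<open>i\<close> of the descent.  Equal letters are trivial and distant ones commute.
  For neighbours, either \<open>j\<close> itself is a descent of the remaining word, and two letters cancel, or
  the remaining word can be written as \<open>i j \<cdots>\<close>, and a braid move brings \<open>i\<close> to the front.  For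
  \<open>n = 2\<close>, where there is no braid relation, periodicity forces the first alternative.
\<close>
lemma exchange:
  assumes n: "n \<ge> 2" and p: "\<And>k. ext n p (k + 1) \<le> ext n (p :: vec) k"
    and "xs \<in> lists {..<n}"
    and "ext n (foldr (vec_refl n) xs p) k < ext n (foldr (vec_refl n) xs p) (k + 1)"
  shows "\<exists>ys. word_eq n xs (letter n k # ys) \<and> length ys < length xs"
  using assms(3,4)
proof (induction xs arbitrary: k rule: length_induct)
  case (1 xs)
  have n0: "n > 0" using n by simp
  have IH: "\<exists>us. word_eq n ys (letter n l # us) \<and> length us < length ys"
    if "length ys < length xs" "ys \<in> lists {..<n}"
      "ext n (foldr (vec_refl n) ys p) l < ext n (foldr (vec_refl n) ys p) (l + 1)" for ys l
    using 1(1) that by blast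
  show ?case
  proof (cases xs)
    case Nil
    then show ?thesis using 1(3) p[of k] by simp
  next
    case (Cons j zs)
    define x where "x = foldr (vec_refl n) zs p"
    define E where "E = ext n x"
    define i where "i = letter n k"
    have j: "j < n" and zs: "zs \<in> lists {..<n}" and i: "i < n"
      using Cons 1(2) letter_less[OF n0] by (auto simp: i_def)
    have ext_xs: "ext n (foldr (vec_refl n) xs p) l = E (idx_refl n k' l)"
      if "[int j = k'] (mod int n)" for l k'
      using idx_refl_cong[OF that, of l] ext_vec_refl[OF n j, of x l]
      unfolding Cons x_def E_def by simp
    have letter_j: "letter n k' = j" if "[int j = k'] (mod int n)" for k'
      using that j unfolding letter_def cong_def by (metis letter_def letter_nat)
    have D: "\<exists>ys. word_eq n zs (letter n l # ys) \<and> length ys < length zs" if "E l < E (l + 1)" for l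
      using IH[OF _ zs, of l] that Cons by (simp add: E_def x_def)
    \<comment> \<open>A descent of the remaining word at the first letter cancels it, and leaves a word shorter by at least two.\<close>
    have cancel: ?thesis if k': "[int j = k'] (mod int n)" and d: "E k' < E (k' + 1)" for k'
    proof -
      obtain ys where ys: "word_eq n zs (j # ys)" "length ys < length zs"
        using D[OF d] letter_j[OF k'] by metis
      have ysl: "ys \<in> lists {..<n}" using word_eq_lists[OF ys(1)] by simp
      have eq: "word_eq n xs ys"
        using word_trans[OF word_eq_Cons[OF ys(1) j] word_eq_cancel[OF j ysl]] Cons by simp
      have "foldr (vec_refl n) xs p = foldr (vec_refl n) ys p"
        by (rule vec_refl_word_eq[OF eq n])
      then obtain us where "word_eq n ys (letter n k # us)" "length us < length ys"
        using IH[of ys k] ysl ys(2) Cons 1(3) by auto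
      then show ?thesis using word_trans[OF eq] ys(2) Cons by (intro exI[of _ us]) auto
    qed
    \<comment> \<open>The indices are reflected because the descent at \<open>k'\<close> is needed after splitting off \<open>i\<close>.\<close>
    have braid: ?thesis
      if n2: "n > 2" and adj: "adjacent n j i" and k': "[int j = k'] (mod int n)"
        and dk: "E k < E (k + 1)"
        and d': "E (idx_refl n k k') < E (idx_refl n k (k' + 1))" for k'
    proof -
      obtain ys where ys: "word_eq n zs (i # ys)" "length ys < length zs"
        using D[OF dk] i_def by blast
      have ysl: "ys \<in> lists {..<n}" using word_eq_lists[OF ys(1)] by simp
      define y where "y = foldr (vec_refl n) ys p"
      have "x = vec_refl n i y" unfolding x_def y_def using vec_refl_word_eq[OF ys(1) n, of p] by simp
      then have y: "y = vec_refl n i x" using vec_refl_involution[OF n i] by simp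
      have "ext n y l = E (idx_refl n k l)" for l
        unfolding y E_def i_def using ext_vec_refl_letter[OF n] .
      with d' have "ext n y k' < ext n y (k' + 1)" by simp
      then obtain us where us: "word_eq n ys (j # us)" "length us < length ys"
        using IH[of ys k'] ysl ys(2) Cons letter_j[OF k'] unfolding y_def by auto
      have usl: "us \<in> lists {..<n}" using word_eq_lists[OF us(1)] by simp
      have "word_eq n (j # zs) (j # i # ys)" by (rule word_eq_Cons[OF ys(1) j])
      moreover have "word_eq n (j # i # ys) (j # i # j # us)"
        by (intro word_eq_Cons us i j)
      moreover have "word_eq n (j # i # j # us) (i # j # i # us)"
        using word_step[OF coxeter_relation.braid[OF n2 j i adj], of "[]" us] usl by simp
      ultimately have "word_eq n xs (i # j # i # us)" using Cons word_trans by blast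
      then show ?thesis using us(2) ys(2) Cons by (intro exI[of _ "j # i # us"]) (auto simp: i_def[symmetric])
    qed
    have ik: "[int i = k] (mod int n)" by (simp add: i_def int_letter[OF n0] cong_def)
    have adjI: "adjacent n j i \<longleftrightarrow> [int j = k + 1] (mod int n) \<or> [int j = k - 1] (mod int n)"
    proof -
      have "[int i + 1 = k + 1] (mod int n)" "[int i - 1 = k - 1] (mod int n)"
        using ik by (simp_all add: cong_add cong_diff)
      then show ?thesis unfolding adjacent_def by (auto simp: cong_def)
    qed
    consider (same) "[int j = k] (mod int n)"
      | (next2) "[int j = k + 1] (mod int n)" "n = 2"
      | (nxt) "[int j = k + 1] (mod int n)" "n > 2"
      | (prev) "[int j = k - 1] (mod int n)" "n > 2"
      | (far) "\<not> [int j = k] (mod int n)" "\<not> [int j = k + 1] (mod int n)" "\<not> [int j = k - 1] (mod int n)" "n > 2"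
    proof -
      have "[int j = k] (mod int n) \<or> [int j = k + 1] (mod int n)" if "n = 2"
        using that by (simp add: cong_def) presburger
      then show ?thesis using that n by fastforce
    qed
    then show ?thesis
    proof cases
      case same
      then show ?thesis using letter_j[OF same] Cons word_refl[OF 1(2)] by auto
    next
      case next2
      have "idx_refl n (k + 1) k = k - 1"
        using next2(2) not_cong_plus[of 1 n k] by (simp add: idx_refl_def cong_def)
      then have lt: "E (k - 1) < E (k + 2)"
        using 1(3) ext_xs[OF next2(1)] idx_refl_simps(1)[OF n, of "k + 1"] by (simp add: add.assoc)
      have "E (k + 2) = E k - 1" "E (k + 1) = E (k - 1) - 1"
        using ext_shift[OF n0, of x k 1] ext_shift[OF n0, of x "k - 1" 1] next2(2)
        unfolding E_def by (simp_all add: add.commute)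
      then show ?thesis using cancel[OF next2(1)] lt by (simp add: add.assoc)
    next
      case nxt
      have nc: "\<not> [k = k + 1] (mod int n)" "\<not> [k = k + 1 + 1] (mod int n)"
         "\<not> [k + 2 = k] (mod int n)" "\<not> [k + 2 = k + 1] (mod int n)"
        using not_cong_plus[of 1 n k] not_cong_plus[of 2 n k] not_cong_plus[of 1 n "k + 1"] nxt(2)
        by (simp_all add: add.assoc)
      have lt: "E k < E (k + 2)"
        using 1(3) ext_xs[OF nxt(1)] idx_refl_simps(1)[OF n, of "k + 1"] idx_refl_other[OF nc(1,2)]
        by (simp add: add.assoc)
      show ?thesis
      proof (cases "E (k + 1) < E (k + 1 + 1)")
        case True
        then show ?thesis by (rule cancel[OF nxt(1)])
      next
        case False
        then have "E k < E (k + 1)" using lt by (simp add: add.assoc)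
        moreover have "E (idx_refl n k (k + 1)) < E (idx_refl n k (k + 1 + 1))"
          using lt idx_refl_simps[OF n, of k] idx_refl_other[OF nc(3,4)] by (simp add: add.assoc)
        ultimately show ?thesis using braid[OF nxt(2) _ nxt(1)] adjI nxt(1) by blast
      qed
    next
      case prev
      have nc: "\<not> [k + 1 = k - 1] (mod int n)" "\<not> [k + 1 = k - 1 + 1] (mod int n)"
         "\<not> [k - 1 = k] (mod int n)" "\<not> [k - 1 = k + 1] (mod int n)"
        using not_cong_plus[of 1 n k] not_cong_plus[of 2 n "k - 1"] prev(2)
        by (simp_all add: add.commute)
      have lt: "E (k - 1) < E (k + 1)"
        using 1(3) ext_xs[OF prev(1)] idx_refl_simps(2)[OF n, of "k - 1"] idx_refl_other[OF nc(1,2)]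
        by simp
      show ?thesis
      proof (cases "E (k - 1) < E (k - 1 + 1)")
        case True
        then show ?thesis by (rule cancel[OF prev(1)])
      next
        case False
        then have "E k < E (k + 1)" using lt by simp
        moreover have "E (idx_refl n k (k - 1)) < E (idx_refl n k (k - 1 + 1))"
          using lt idx_refl_simps[OF n, of k] idx_refl_other[OF nc(3,4)] by simp
        ultimately show ?thesis using braid[OF prev(2) _ prev(1)] adjI prev(1) by blast
      qed
    next
      case far
      have nc: "\<not> [k = int j] (mod int n)" "\<not> [k = int j + 1] (mod int n)"
         "\<not> [k + 1 = int j] (mod int n)" "\<not> [k + 1 = int j + 1] (mod int n)"
        using far by (auto simp: cong_iff_dvd_diff dvd_diff_commute algebra_simps)
      have "E k < E (k + 1)"
        using 1(3) ext_xs[OF cong_refl] idx_refl_other[OF nc(1,2)] idx_refl_other[OF nc(3,4)] by simp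
      then obtain ys where ys: "word_eq n zs (i # ys)" "length ys < length zs"
        using D i_def by blast
      have ysl: "ys \<in> lists {..<n}" using word_eq_lists[OF ys(1)] by simp
      have "\<not> adjacent n j i" using adjI far by blast
      then have "word_eq n (j # i # ys) (i # j # ys)"
        using word_step[OF commute[OF far(4) j i], of "[]" ys] ysl by simp
      then have "word_eq n xs (i # j # ys)"
        using word_trans[OF word_eq_Cons[OF ys(1) j]] Cons by blast
      then show ?thesis using ys(2) Cons by (intro exI[of _ "j # ys"]) (auto simp: i_def[symmetric])
    qed
  qed
qed

section \<open>Coxeter length as the number of separating hyperplanes\<close>

definition regular :: "nat \<Rightarrow> vec \<Rightarrow> bool" where
  "regular n x \<longleftrightarrow> (\<forall>a\<in>{1..n}. \<forall>b\<in>{1..n}. a \<noteq> b \<longrightarrow> x a - x b \<notin> \<int>)"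

definition index_pairs :: "nat \<Rightarrow> (nat \<times> nat) set" where
  "index_pairs n = {(a, b). 1 \<le> a \<and> a < b \<and> b \<le> n}"

text \<open>
  The number of hyperplanes between \<open>x\<close> and the fundamental alcove: for a pair with floor \<open>k \<ge> 0\<close> these
  are the levels \<open>1, \<dots>, k\<close>, for \<open>k < 0\<close> the levels \<open>k + 1, \<dots>, 0\<close>.
\<close>
definition separation :: "nat \<Rightarrow> vec \<Rightarrow> nat" where
  "separation n x = (\<Sum>(a, b)\<in>index_pairs n. nat \<bar>\<lfloor>x a - x b\<rfloor>\<bar>)"

lemma finite_index_pairs: "finite (index_pairs n)"
  by (rule finite_subset[of _ "{1..n} \<times> {1..n}"]) (auto simp: index_pairs_def)

lemma floor_minus_nonint: "(z::real) \<notin> \<int> \<Longrightarrow> \<lfloor>- z\<rfloor> = - 1 - \<lfloor>z\<rfloor>"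
  unfolding floor_minus ceiling_altdef by (auto simp: Ints_def)

lemma floor_swap:
  assumes "regular n x" "a \<in> {1..n}" "b \<in> {1..n}" "a \<noteq> b"
  shows "\<lfloor>x b - x a\<rfloor> = - 1 - \<lfloor>x a - x b\<rfloor>"
  using floor_minus_nonint[of "x a - x b"] assms unfolding regular_def by simp

text \<open>
  A reflection permutes the pairs other than that of its own wall.  For the affine generator a pair
  \<open>(1, b)\<close> corresponds to \<open>(b, n)\<close>, and the change of orientation is compensated by the shift by one,
  as \<open>\<lfloor>- z\<rfloor> = - 1 - \<lfloor>z\<rfloor>\<close> for nonintegral \<open>z\<close>.
\<close>
lemma separation_descent:
  assumes n: "n \<ge> 2" and i: "i < n" and reg: "regular n x"
    and desc: "ext n x (int i) < ext n x (int i + 1)"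
  shows "Suc (separation n (vec_refl n i x)) = separation n x"
proof -
  let ?y = "vec_refl n i x" and ?P = "index_pairs n"
  let ?e = "if i = 0 then (1, n) else (i, i + 1)"
  let ?g = "\<lambda>x (a, b). nat \<bar>\<lfloor>x a - x b :: real\<rfloor>\<bar>"
  have e: "?e \<in> ?P" using n i by (auto simp: index_pairs_def)
  have split: "separation n z = ?g z ?e + sum (?g z) (?P - {?e})" for z
    unfolding separation_def by (rule sum.remove[OF finite_index_pairs e])
  have "sum (?g ?y) (?P - {?e}) = sum (?g x) (?P - {?e})"
  proof (cases "i = 0")
    case False
    let ?t = "Transposition.transpose i (i + 1)"
    have y: "?y a = x (?t a)" for a
      using False by (simp add: vec_refl_def Transposition.transpose_def)
    let ?f = "\<lambda>(a, b). (?t a, ?t b)"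
    show ?thesis
    proof (rule sum.reindex_bij_witness[of _ ?f ?f])
      fix q assume q: "q \<in> ?P - {?e}"
      show "?f (?f q) = q" by (simp add: split_beta)
      show "?f (?f q) = q" by (simp add: split_beta)
      show "?f q \<in> ?P - {?e}" using q False i
        by (auto simp: index_pairs_def Transposition.transpose_def split: if_splits)
      show "?f q \<in> ?P - {?e}" using q False i
        by (auto simp: index_pairs_def Transposition.transpose_def split: if_splits)
      show "?g x (?f q) = ?g ?y q" by (simp add: split_beta y)
    qed
  next
    case True
    let ?f = "\<lambda>(a, b). if a = 1 then (b, n) else if b = n then (1, a) else (a, b)"
    show ?thesis
    proof (rule sum.reindex_bij_witness[of _ ?f ?f])
      fix q assume q: "q \<in> ?P - {?e}"
      obtain a b where ab: "q = (a, b)" by (cases q)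
      have ab': "1 \<le> a" "a < b" "b \<le> n" "\<not> (a = 1 \<and> b = n)"
        using q ab True by (auto simp: index_pairs_def)
      show "?f (?f q) = q" using ab' by (auto simp: ab)
      show "?f (?f q) = q" using ab' by (auto simp: ab)
      show "?f q \<in> ?P - {?e}" using ab' True by (auto simp: ab index_pairs_def)
      show "?f q \<in> ?P - {?e}" using ab' True by (auto simp: ab index_pairs_def)
      show "?g x (?f q) = ?g ?y q"
      proof -
        have n1: "n \<noteq> 1" using n by simp
        consider "a = 1" "b \<noteq> n" | "a \<noteq> 1" "b = n" | "a \<noteq> 1" "b \<noteq> n" using ab' by blast
        then show ?thesis
        proof cases
          case 1
          have "\<lfloor>x n + 1 - x b\<rfloor> = \<lfloor>x n - x b\<rfloor> + 1" by linarith
          also have "\<dots> = - \<lfloor>x b - x n\<rfloor>" using floor_swap[OF reg, of b n] ab' 1 n by simp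
          finally show ?thesis using 1 ab' True n1 by (simp add: ab vec_refl_def)
        next
          case 2
          have "\<lfloor>x a - (x 1 - 1)\<rfloor> = \<lfloor>x a - x 1\<rfloor> + 1" by linarith
          also have "\<dots> = - \<lfloor>x 1 - x a\<rfloor>" using floor_swap[OF reg, of 1 a] ab' 2 n by simp
          finally show ?thesis using 2 ab' True n1 by (simp add: ab vec_refl_def)
        next
          case 3
          then show ?thesis using ab' True by (simp add: ab vec_refl_def)
        qed
      qed
    qed
  qed
  moreover have "Suc (?g ?y ?e) = ?g x ?e"
  proof (cases "i = 0")
    case True
    then have lt: "x n + 1 < x 1" using desc ext_zero[of n x] ext_nat[of 1 n x] n by simp
    have "\<lfloor>x n - x 1\<rfloor> = - 1 - \<lfloor>x 1 - x n\<rfloor>" using floor_swap[OF reg, of 1 n] n by simp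
    moreover have "\<lfloor>?y 1 - ?y n\<rfloor> = \<lfloor>x n - x 1\<rfloor> + 2"
      using True n unfolding vec_refl_def by simp
    moreover have "\<lfloor>x 1 - x n\<rfloor> \<ge> 1" using lt by linarith
    ultimately have "Suc (nat \<bar>\<lfloor>?y 1 - ?y n\<rfloor>\<bar>) = nat \<bar>\<lfloor>x 1 - x n\<rfloor>\<bar>" by linarith
    then show ?thesis using True by simp
  next
    case False
    then have lt: "x i < x (i + 1)"
      using desc ext_nat[of i n x] ext_nat[of "i + 1" n x] i by (simp add: add.commute)
    have "\<lfloor>x (i + 1) - x i\<rfloor> = - 1 - \<lfloor>x i - x (i + 1)\<rfloor>"
      using floor_swap[OF reg, of i "i + 1"] False i by simp
    moreover have "\<lfloor>x i - x (i + 1)\<rfloor> \<le> - 1" using lt by linarith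
    ultimately show ?thesis using False by (simp add: vec_refl_def)
  qed
  ultimately show ?thesis unfolding split by simp
qed

lemma regular_foldr:
  assumes n: "n \<ge> 2" and xs: "xs \<in> lists {..<n}" and p: "regular n p"
  shows "regular n (foldr (vec_refl n) xs p)"
proof -
  obtain c :: "nat \<Rightarrow> int" and \<pi> where c: "\<pi> permutes {1..n}"
    "foldr (vec_refl n) xs p = (\<lambda>a. p (\<pi> a) + of_int (c a))"
    using word_affine[OF n xs] by blast
  show ?thesis unfolding regular_def
  proof (intro ballI impI)
    fix a b assume ab: "a \<in> {1..n}" "b \<in> {1..n}" "a \<noteq> b"
    then have "p (\<pi> a) - p (\<pi> b) \<notin> \<int>"
      using p permutes_in_image[OF c(1)] permutes_inj[OF c(1)] unfolding regular_def
      by (metis injD)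
    moreover have "p (\<pi> a) - p (\<pi> b) = (foldr (vec_refl n) xs p a - foldr (vec_refl n) xs p b) - of_int (c a - c b)"
      unfolding c(2) by simp
    ultimately show "foldr (vec_refl n) xs p a - foldr (vec_refl n) xs p b \<notin> \<int>"
      by (metis Ints_diff Ints_of_int)
  qed
qed

lemma regular_ext_neq:
  assumes n: "n \<ge> 2" and reg: "regular n x" and i: "i < n"
  shows "ext n x (int i) \<noteq> ext n x (int i + 1)"
proof (cases "i = 0")
  case True
  have "x 1 - x n \<notin> \<int>" using reg n unfolding regular_def by auto
  then have "x n + 1 \<noteq> x 1" by (metis Ints_1 add_diff_cancel_left')
  then show ?thesis using True ext_zero[of n x] ext_nat[of 1 n x] n by simp
next
  case False
  have "x i - x (i + 1) \<notin> \<int>" using reg n i False unfolding regular_def by auto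
  then have "x i \<noteq> x (i + 1)" by auto
  then show ?thesis using False ext_nat[of i n x] ext_nat[of "i + 1" n x] i by (simp add: add.commute)
qed

lemma separation_ascent:
  assumes n: "n \<ge> 2" and i: "i < n" and reg: "regular n x"
    and asc: "\<not> ext n x (int i) < ext n x (int i + 1)"
  shows "separation n (vec_refl n i x) = Suc (separation n x)"
proof -
  let ?y = "vec_refl n i x"
  have "regular n ?y" using regular_foldr[OF n _ reg, of "[i]"] i by simp
  moreover have "ext n ?y (int i) < ext n ?y (int i + 1)"
    using ext_vec_refl[OF n i, of x] idx_refl_simps[OF n, of "int i"] regular_ext_neq[OF n reg i] asc
    by simp
  ultimately show ?thesis
    using separation_descent[OF n i, of ?y] vec_refl_involution[OF n i, of x] by simp
qed

lemma ip_root: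
  assumes "a \<in> {1..n}" "b \<in> {1..n}"
  shows "ip n p (root_vec a b) = p a - p b"
proof -
  have e: "(\<Sum>i=1..n. p i * eps c i) = p c" if "c \<in> {1..n}" for c
  proof -
    have "(\<Sum>i=1..n. p i * eps c i) = (\<Sum>i=1..n. if i = c then p i else 0)"
      by (rule sum.cong) (auto simp: eps_def)
    then show ?thesis using that by simp
  qed
  have "ip n p (root_vec a b) = (\<Sum>i=1..n. p i * eps a i) - (\<Sum>i=1..n. p i * eps b i)"
    by (simp add: ip_def root_vec_def right_diff_distrib sum_subtractf)
  then show ?thesis using e assms by simp
qed

lemma fundamental_alcove_iff:
  assumes n: "n \<ge> 2"
  shows "p \<in> fundamental_alcove n \<longleftrightarrow> p \<in> hyperspace n \<and>
    (\<forall>a b. 1 \<le> a \<longrightarrow> a < b \<longrightarrow> b \<le> n \<longrightarrow> p b < p a \<and> p a < p b + 1)"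
proof -
  have s: "ip n p (simple_root i) = p i - p (i + 1)" if "i \<in> {1..n-1}" for i
    using ip_root[of i n "i + 1"] that n unfolding simple_root_def by auto
  have h: "ip n p (highest_root n) = p 1 - p n"
    using ip_root[of 1 n n] n unfolding highest_root_def by auto
  have "p b < p a \<and> p a < p b + 1"
    if desc: "\<forall>i\<in>{1..n-1}. p (i + 1) < p i" and top: "p 1 - p n < 1"
      and ab: "1 \<le> a" "a < b" "b \<le> n" for a b
  proof -
    have mono: "p d \<le> p c" if "1 \<le> c" "c \<le> d" "d \<le> n" for c d
      using that(2) that(1,3)
    proof (induction d rule: dec_induct)
      case (step k)
      then have "k \<in> {1..n-1}" by auto
      then have "p (k + 1) < p k" using desc by blast
      then show ?case using step by simp
    qed simp
    have "p b \<le> p (a + 1)" "p (a + 1) < p a" using mono[of "a + 1" b] desc ab by auto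
    moreover have "p a \<le> p 1" "p n \<le> p b" using mono ab by auto
    ultimately show ?thesis using top by linarith
  qed
  note chain = this
  show ?thesis
  proof
    assume L: "p \<in> fundamental_alcove n"
    then have "\<forall>i\<in>{1..n-1}. p (i + 1) < p i" "p 1 - p n < 1"
      using s h by (simp_all add: fundamental_alcove_def)
    with L show "p \<in> hyperspace n \<and>
        (\<forall>a b. 1 \<le> a \<longrightarrow> a < b \<longrightarrow> b \<le> n \<longrightarrow> p b < p a \<and> p a < p b + 1)"
      using chain unfolding fundamental_alcove_def by blast
  next
    assume R: "p \<in> hyperspace n \<and>
        (\<forall>a b. 1 \<le> a \<longrightarrow> a < b \<longrightarrow> b \<le> n \<longrightarrow> p b < p a \<and> p a < p b + 1)"
    have "ip n p (simple_root i) > 0" if i: "i \<in> {1..n-1}" for i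
    proof -
      have "1 \<le> i" "i < i + 1" "i + 1 \<le> n" using i n by auto
      then have "p (i + 1) < p i" using R by blast
      then show ?thesis using s[OF i] by simp
    qed
    moreover have "p 1 < p n + 1" using R n by simp
    ultimately show "p \<in> fundamental_alcove n"
      using R h unfolding fundamental_alcove_def by simp
  qed
qed

lemma fundamental_regular:
  assumes n: "n \<ge> 2" and p: "p \<in> fundamental_alcove n"
  shows "regular n p"
proof -
  have "p a - p b \<notin> \<int>" if ab: "a \<in> {1..n}" "b \<in> {1..n}" "a \<noteq> b" for a b
  proof
    assume "p a - p b \<in> \<int>"
    then obtain k where k: "p a - p b = of_int k" by (auto elim: Ints_cases)
    have F: "p d < p c \<and> p c < p d + 1" if "1 \<le> c" "c < d" "d \<le> n" for c d
      using p that fundamental_alcove_iff[OF n, of p] by blast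
    have "- 1 < p a - p b \<and> p a - p b < 1 \<and> p a - p b \<noteq> 0"
      using F[of a b] F[of b a] ab by (cases "a < b") auto
    then have "- 1 < k" "k < 1" "k \<noteq> 0" unfolding k by simp_all
    then show False by simp
  qed
  then show ?thesis by (simp add: regular_def)
qed

lemma fundamental_ascents:
  assumes n: "n \<ge> 2" and p: "p \<in> fundamental_alcove n"
  shows "ext n p (k + 1) \<le> ext n p k"
proof -
  have n0: "n > 0" using n by simp
  obtain a t where a: "1 \<le> a" "a \<le> n" and k: "k = int a + int n * t"
    using int_as_window[OF n0] .
  note F = fundamental_alcove_iff[OF n, THEN iffD1, OF p, THEN conjunct2, rule_format]
  have "ext n p (int a + 1) \<le> ext n p (int a)"
  proof (cases "a = n")
    case True
    then show ?thesis using ext_Suc_n[OF n0, of p] ext_nat[OF a, of p] F[of 1 n] n by simp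
  next
    case False
    then show ?thesis using ext_nat[of "a + 1" n p] ext_nat[OF a, of p] F[of a "a + 1"] a
      by (simp add: add.commute)
  qed
  moreover have "k + 1 = (int a + 1) + int n * t" by (simp add: k)
  ultimately show ?thesis unfolding k using ext_shift[OF n0, of p] by (metis diff_right_mono)
qed

lemma separation_fundamental:
  assumes n: "n \<ge> 2" and p: "p \<in> fundamental_alcove n"
  shows "separation n p = 0"
proof -
  have "\<lfloor>p a - p b\<rfloor> = 0" if "(a, b) \<in> index_pairs n" for a b
  proof -
    have "p b < p a \<and> p a < p b + 1"
      using fundamental_alcove_iff[OF n, of p] p that unfolding index_pairs_def by simp
    then show ?thesis by linarith
  qed
  then show ?thesis unfolding separation_def by (intro sum.neutral) auto
qed

text \<open>
  In a shortest word every letter crosses a new hyperplane: otherwise \<open>exchange\<close> would move this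
  letter to the front of the remaining word and cancel it.
\<close>
lemma reduced_separation:
  assumes n: "n \<ge> 2" and p: "p \<in> fundamental_alcove n" and "xs \<in> lists {..<n}"
    and "\<And>ys. word_eq n xs ys \<Longrightarrow> length xs \<le> length ys"
  shows "separation n (foldr (vec_refl n) xs p) = length xs"
  using assms(3,4)
proof (induction xs)
  case Nil
  then show ?case using separation_fundamental[OF n p] by simp
next
  case (Cons i xs)
  have i: "i < n" and xs: "xs \<in> lists {..<n}" using Cons by auto
  let ?x = "foldr (vec_refl n) xs p"
  have reg: "regular n ?x"
    using regular_foldr[OF n xs fundamental_regular[OF n p]] .
  have "length xs \<le> length ys" if "word_eq n xs ys" for ys
    using Cons.prems(1)[OF word_eq_Cons[OF that i]] by simp
  then have IH: "separation n ?x = length xs" using Cons.IH xs by blast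
  have "\<not> ext n ?x (int i) < ext n ?x (int i + 1)"
  proof
    assume "ext n ?x (int i) < ext n ?x (int i + 1)"
    then obtain ys where ys: "word_eq n xs (i # ys)" "length ys < length xs"
      using exchange[OF n fundamental_ascents[OF n p] xs, of "int i"] letter_nat[OF i] by auto
    have "ys \<in> lists {..<n}" using word_eq_lists[OF ys(1)] by simp
    then have "word_eq n (i # xs) ys"
      using word_trans[OF word_eq_Cons[OF ys(1) i] word_eq_cancel[OF i]] by simp
    then show False using Cons.prems(1)[of ys] ys(2) by simp
  qed
  then show ?case using separation_ascent[OF n i reg] IH by simp
qed

lemma class_in_carrier: "xs \<in> lists {..<n} \<Longrightarrow> word_rel n `` {xs} \<in> carrier (affine_sym n)"
  by (auto simp: affine_sym_def intro: quotientI)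

lemma carrierE:
  assumes "u \<in> carrier (affine_sym n)"
  obtains xs where "xs \<in> lists {..<n}" "u = word_rel n `` {xs}"
proof -
  have "u \<in> lists {..<n} // word_rel n" using assms by (simp add: affine_sym_def)
  then show ?thesis by (rule quotientE) (rule that)
qed

lemma class_eq: "word_eq n xs ys \<Longrightarrow> word_rel n `` {xs} = word_rel n `` {ys}"
  by (rule equiv_class_eq[OF equiv_word_rel]) (simp add: word_rel_def)

lemma shortest_word:
  assumes "u \<in> carrier (affine_sym n)"
  obtains xs where "xs \<in> lists {..<n}" "u = word_rel n `` {xs}" "length xs = cox_length u"
proof -
  obtain ys where ys: "ys \<in> lists {..<n}" "u = word_rel n `` {ys}" using assms by (rule carrierE)
  let ?Q = "\<lambda>k. \<exists>zs\<in>u. length zs = k"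
  have "?Q (length ys)" using word_refl[OF ys(1)] by (intro bexI[of _ ys]) (simp_all add: ys word_rel_def)
  from LeastI[of ?Q, OF this] obtain xs where xs: "xs \<in> u" "length xs = cox_length u"
    unfolding cox_length_def by blast
  have eq: "word_eq n ys xs" using xs(1) by (simp add: ys word_rel_def)
  then have "u = word_rel n `` {xs}" using class_eq ys(2) by blast
  then show ?thesis using that[of xs] xs(2) word_eq_lists[OF eq] by blast
qed

lemma cox_length_le: "xs \<in> u \<Longrightarrow> cox_length u \<le> length xs"
  unfolding cox_length_def by (rule Least_le) blast

lemma cox_length_separation:
  assumes n: "n \<ge> 2" and p: "p \<in> fundamental_alcove n" and xs: "xs \<in> lists {..<n}"
  shows "cox_length (word_rel n `` {xs}) = separation n (foldr (vec_refl n) xs p)"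
proof -
  obtain ys where ys: "ys \<in> lists {..<n}" "word_rel n `` {xs} = word_rel n `` {ys}"
    "length ys = cox_length (word_rel n `` {xs})"
    using shortest_word[OF class_in_carrier[OF xs]] .
  have eq: "word_eq n xs ys" using ys(2) word_refl[OF ys(1)] by (auto simp: word_rel_def)
  have "length ys \<le> length zs" if "word_eq n ys zs" for zs
    using cox_length_le[of zs "word_rel n `` {ys}"] that ys(2,3) by (simp add: word_rel_def)
  then have "separation n (foldr (vec_refl n) ys p) = length ys"
    by (rule reduced_separation[OF n p ys(1)])
  then show ?thesis using vec_refl_word_eq[OF eq n, of p] ys(3) by simp
qed

section \<open>Alcoves and Shi regions as classes of points\<close>

definition arr_complement :: "nat \<Rightarrow> int set \<Rightarrow> vec set" where
  "arr_complement n K = {v \<in> hyperspace n. \<forall>(a, b)\<in>index_pairs n. \<forall>k\<in>K. v a - v b \<noteq> of_int k}"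

definition same_side :: "nat \<Rightarrow> int set \<Rightarrow> vec \<Rightarrow> vec \<Rightarrow> bool" where
  "same_side n K x y \<longleftrightarrow> (\<forall>(a, b)\<in>index_pairs n. \<forall>k\<in>K. x a - x b < of_int k \<longleftrightarrow> y a - y b < of_int k)"

lemma arr_complement_eq:
  "hyperspace n - (\<Union>\<alpha>\<in>pos_roots n. \<Union>k\<in>K. hyp n \<alpha> k) = arr_complement n K"
proof -
  have ip: "ip n v (root_vec a b) = v a - v b" if "(a, b) \<in> index_pairs n" for v a b
    using that ip_root[of a n b v] unfolding index_pairs_def by auto
  have roots: "pos_roots n = (\<lambda>(a, b). root_vec a b) ` index_pairs n"
    by (auto simp: pos_roots_def index_pairs_def)
  show ?thesis
    unfolding roots arr_complement_def hyp_def using ip by auto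
qed

lemma continuous_coordinate_difference: "continuous_on T (\<lambda>v::vec. v a - v b)"
  by (intro continuous_on_diff continuous_on_subset[OF continuous_on_product_coordinates subset_UNIV])

text \<open>
  Along a connected set, a coordinate difference takes all intermediate values, hence cannot change
  sides without meeting a hyperplane; conversely, points on the same side of all hyperplanes are
  joined by a segment.
\<close>
lemma connected_component_arr_complement:
  assumes x: "x \<in> arr_complement n K"
  shows "connected_component_set (arr_complement n K) x = {y \<in> arr_complement n K. same_side n K x y}"
proof (intro equalityI subsetI)
  fix y assume "y \<in> connected_component_set (arr_complement n K) x"
  then obtain T where T: "connected T" "T \<subseteq> arr_complement n K" "x \<in> T" "y \<in> T"
    unfolding connected_component_def by auto
  have "x a - x b < of_int k \<longleftrightarrow> y a - y b < of_int k" if ab: "(a, b) \<in> index_pairs n" and k: "k \<in> K" for a b k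
  proof (rule ccontr)
    assume *: "\<not> ?thesis"
    let ?f = "\<lambda>v::vec. v a - v b"
    have "connected (?f ` T)"
      by (rule connected_continuous_image[OF continuous_coordinate_difference T(1)])
    moreover have "?f x \<in> ?f ` T" "?f y \<in> ?f ` T" using T by auto
    ultimately have "{?f x..?f y} \<subseteq> ?f ` T" "{?f y..?f x} \<subseteq> ?f ` T"
      using connected_contains_Icc by blast+
    moreover have "of_int k \<in> {?f x..?f y} \<or> of_int k \<in> {?f y..?f x}" using * by auto
    ultimately have "of_int k \<in> ?f ` T" by blast
    then obtain v where "v \<in> T" "v a - v b = of_int k" by force
    then show False using T(2) ab k unfolding arr_complement_def by blast
  qed
  then show "y \<in> {y \<in> arr_complement n K. same_side n K x y}"
    using T unfolding same_side_def by blast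
next
  fix y assume y: "y \<in> {y \<in> arr_complement n K. same_side n K x y}"
  define s where "s = (\<lambda>t::real. (\<lambda>a. (1 - t) * x a + t * y a))"
  have "continuous_on {0..1} s"
    unfolding s_def by (intro continuous_on_coordinatewise_then_product continuous_intros)
  then have "connected (s ` {0..1})" by (rule connected_continuous_image) simp
  moreover have "x \<in> s ` {0..1}" by (rule image_eqI[of _ _ 0]) (simp_all add: s_def)
  moreover have "y \<in> s ` {0..1}" by (rule image_eqI[of _ _ 1]) (simp_all add: s_def)
  moreover have "s ` {0..1} \<subseteq> arr_complement n K"
  proof
    fix v assume "v \<in> s ` {0..1}"
    then obtain t where t: "0 \<le> t" "t \<le> 1" and v: "v = s t" by auto
    have hx: "x \<in> hyperspace n" and hy: "y \<in> hyperspace n"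
      using x y unfolding arr_complement_def by auto
    have "(\<Sum>i=1..n. v i) = (1 - t) * (\<Sum>i=1..n. x i) + t * (\<Sum>i=1..n. y i)"
      unfolding v s_def by (simp add: sum.distrib sum_distrib_left)
    then have "v \<in> hyperspace n" using hx hy unfolding hyperspace_def v s_def by simp
    moreover have "v a - v b \<noteq> of_int k" if ab: "(a, b) \<in> index_pairs n" and k: "k \<in> K" for a b k
    proof -
      have ne: "x a - x b \<noteq> of_int k" "y a - y b \<noteq> of_int k"
        using x y ab k unfolding arr_complement_def by blast+
      have ss: "x a - x b < of_int k \<longleftrightarrow> y a - y b < of_int k"
        using y ab k unfolding same_side_def by blast
      have vab: "v a - v b = (1 - t) * (x a - x b) + t * (y a - y b)"
        unfolding v s_def by (simp add: algebra_simps)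
      show ?thesis
      proof (cases "x a - x b < of_int k")
        case True
        then show ?thesis using ss convex_bound_lt[of "x a - x b" "of_int k" "y a - y b" "1 - t" t] t
          unfolding vab by simp
      next
        case False
        then have "- (x a - x b) < - of_int k" "- (y a - y b) < - of_int k" using ss ne by auto
        then show ?thesis using convex_bound_lt[of "- (x a - x b)" "- of_int k" "- (y a - y b)" "1 - t" t] t
          unfolding vab by (simp add: algebra_simps)
      qed
    qed
    ultimately show "v \<in> arr_complement n K" unfolding arr_complement_def by blast
  qed
  ultimately show "y \<in> connected_component_set (arr_complement n K) x"
    unfolding connected_component_def by blast
qed

lemma components_arr_complement:
  "components (arr_complement n K) =
     (\<lambda>x. {y \<in> arr_complement n K. same_side n K x y}) ` arr_complement n K"
  unfolding components_def using connected_component_arr_complement by (intro image_cong) auto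

lemma same_side_floor:
  assumes "\<And>a b. (a, b) \<in> index_pairs n \<Longrightarrow> \<lfloor>x a - x b\<rfloor> = \<lfloor>y a - y b\<rfloor>"
  shows "same_side n K x y"
proof -
  have "x a - x b < of_int k \<longleftrightarrow> y a - y b < of_int k" if "(a, b) \<in> index_pairs n" for a b k
    using assms[OF that] floor_less_iff[of "x a - x b" k] floor_less_iff[of "y a - y b" k] by simp
  then show ?thesis unfolding same_side_def by blast
qed

lemma same_side_UNIV:
  "same_side n UNIV x y \<longleftrightarrow> (\<forall>(a, b)\<in>index_pairs n. \<lfloor>x a - x b\<rfloor> = \<lfloor>y a - y b\<rfloor>)"
proof
  assume *: "same_side n UNIV x y"
  have "\<lfloor>x a - x b\<rfloor> = \<lfloor>y a - y b\<rfloor>" if "(a, b) \<in> index_pairs n" for a b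
  proof -
    have "\<lfloor>x a - x b\<rfloor> < k \<longleftrightarrow> \<lfloor>y a - y b\<rfloor> < k" for k
      using * that unfolding same_side_def floor_less_iff by blast
    from this[of "\<lfloor>x a - x b\<rfloor>"] this[of "\<lfloor>y a - y b\<rfloor>"] show ?thesis by linarith
  qed
  then show "\<forall>(a, b)\<in>index_pairs n. \<lfloor>x a - x b\<rfloor> = \<lfloor>y a - y b\<rfloor>" by blast
qed (use same_side_floor in blast)

lemma regular_arr_complement:
  assumes "x \<in> hyperspace n" "regular n x" shows "x \<in> arr_complement n K"
proof -
  have "x a - x b \<noteq> of_int k" if "(a, b) \<in> index_pairs n" for a b k
  proof -
    have "a \<in> {1..n}" "b \<in> {1..n}" "a \<noteq> b" using that by (auto simp: index_pairs_def)
    then have "x a - x b \<notin> \<int>" using assms(2) unfolding regular_def by blast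
    then show ?thesis by auto
  qed
  then show ?thesis using assms(1) unfolding arr_complement_def by blast
qed

lemma arr_complement_UNIV:
  "arr_complement n UNIV = {x \<in> hyperspace n. regular n x}"
proof -
  have "regular n x" if x: "x \<in> arr_complement n UNIV" for x
  proof -
    have lt: "x a - x b \<notin> \<int>" if "a \<in> {1..n}" "b \<in> {1..n}" "a < b" for a b
      using x that unfolding arr_complement_def index_pairs_def by (auto elim!: Ints_cases)
    have "x a - x b \<notin> \<int>" if "a \<in> {1..n}" "b \<in> {1..n}" "b < a" for a b
      using lt[of b a] that Ints_minus[of "x a - x b"] by auto
    with lt show ?thesis unfolding regular_def by (metis linorder_neqE_nat)
  qed
  moreover have "x \<in> hyperspace n" if "x \<in> arr_complement n UNIV" for x
    using that by (simp add: arr_complement_def)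
  ultimately show ?thesis using regular_arr_complement[of _ n UNIV] by blast
qed

lemma alcove_of_word:
  assumes n: "n \<ge> 2" and xs: "xs \<in> lists {..<n}"
  shows "alcove_of n (word_rel n `` {xs}) = foldr (vec_refl n) xs ` fundamental_alcove n"
proof -
  have "word_act (vec_refl n) (word_rel n `` {xs}) v = foldr (vec_refl n) xs v" for v
  proof -
    have "(\<lambda>ys. foldr (vec_refl n) ys v) ` (word_rel n `` {xs}) = {foldr (vec_refl n) xs v}"
    proof (intro equalityI subsetI)
      fix u assume "u \<in> (\<lambda>ys. foldr (vec_refl n) ys v) ` (word_rel n `` {xs})"
      then obtain ys where "word_eq n xs ys" "u = foldr (vec_refl n) ys v"
        by (auto simp: word_rel_def)
      then show "u \<in> {foldr (vec_refl n) xs v}" using vec_refl_word_eq[OF _ n, of xs ys v] by simp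
    next
      fix u assume "u \<in> {foldr (vec_refl n) xs v}"
      then show "u \<in> (\<lambda>ys. foldr (vec_refl n) ys v) ` (word_rel n `` {xs})"
        using word_refl[OF xs] by (intro image_eqI[of _ _ xs]) (auto simp: word_rel_def)
    qed
    then show ?thesis by (simp add: word_act_def)
  qed
  then show ?thesis unfolding alcove_of_def by simp
qed

lemma floors_pairs_all:
  assumes reg: "regular n x" "regular n y"
    and eq: "\<And>a b. (a, b) \<in> index_pairs n \<Longrightarrow> \<lfloor>x a - x b\<rfloor> = \<lfloor>y a - y b\<rfloor>"
    and ab: "a \<in> {1..n}" "b \<in> {1..n}" "a \<noteq> b"
  shows "\<lfloor>x a - x b\<rfloor> = \<lfloor>y a - y b\<rfloor>"
proof (cases "a < b")
  case True
  then show ?thesis using eq[of a b] ab by (simp add: index_pairs_def)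
next
  case False
  then have "\<lfloor>x b - x a\<rfloor> = \<lfloor>y b - y a\<rfloor>" using eq[of b a] ab by (simp add: index_pairs_def)
  then show ?thesis using floor_swap[OF reg(1), of a b] floor_swap[OF reg(2), of a b] ab by simp
qed

lemma alcove_points:
  assumes n: "n \<ge> 2" and xs: "xs \<in> lists {..<n}" and p: "p \<in> fundamental_alcove n"
  shows "foldr (vec_refl n) xs ` fundamental_alcove n =
    {y \<in> arr_complement n UNIV. same_side n UNIV (foldr (vec_refl n) xs p) y}"
proof -
  let ?w = "foldr (vec_refl n) xs"
  obtain c :: "nat \<Rightarrow> int" and \<pi> where \<pi>: "\<pi> permutes {1..n}"
    and w: "\<And>p. ?w p = (\<lambda>a. p (\<pi> a) + of_int (c a))"
    using word_affine[OF n xs] by blast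
  note inj = permutes_inj[OF \<pi>] and im = permutes_in_image[OF \<pi>]
  have hyp: "q \<in> hyperspace n" if "q \<in> fundamental_alcove n" for q
    using that by (simp add: fundamental_alcove_def)
  have fl: "\<lfloor>?w q a - ?w q b\<rfloor> = \<lfloor>q (\<pi> a) - q (\<pi> b)\<rfloor> + (c a - c b)" for q a b
  proof -
    have "?w q a - ?w q b = q (\<pi> a) - q (\<pi> b) + of_int (c a - c b)" unfolding w by simp
    then show ?thesis by (simp only: floor_add_int)
  qed
  have f0: "\<lfloor>q a - q b\<rfloor> = 0" if "q \<in> fundamental_alcove n" "(a, b) \<in> index_pairs n" for q a b
  proof -
    have "q b < q a \<and> q a < q b + 1"
      using fundamental_alcove_iff[OF n, of q] that unfolding index_pairs_def by simp
    then show ?thesis by linarith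
  qed
  note reg = fundamental_regular[OF n]
  show ?thesis
  proof (intro equalityI subsetI)
    fix y assume "y \<in> ?w ` fundamental_alcove n"
    then obtain q where q: "q \<in> fundamental_alcove n" "y = ?w q" by blast
    have "\<lfloor>?w p a - ?w p b\<rfloor> = \<lfloor>y a - y b\<rfloor>" if "(a, b) \<in> index_pairs n" for a b
    proof -
      have "\<pi> a \<in> {1..n}" "\<pi> b \<in> {1..n}" "\<pi> a \<noteq> \<pi> b"
        using that im[of a] im[of b] injD[OF inj, of a b] unfolding index_pairs_def by auto
      then have "\<lfloor>p (\<pi> a) - p (\<pi> b)\<rfloor> = \<lfloor>q (\<pi> a) - q (\<pi> b)\<rfloor>"
        using floors_pairs_all[OF reg[OF p] reg[OF q(1)]] f0[OF p] f0[OF q(1)] by simp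
      then show ?thesis unfolding q(2) fl by simp
    qed
    then have "same_side n UNIV (?w p) y" unfolding same_side_UNIV by blast
    moreover have "y \<in> arr_complement n UNIV"
      unfolding q(2) arr_complement_UNIV
      using foldr_hyperspace[OF n xs hyp[OF q(1)]] regular_foldr[OF n xs reg[OF q(1)]] by simp
    ultimately show "y \<in> {y \<in> arr_complement n UNIV. same_side n UNIV (?w p) y}" by simp
  next
    fix y assume "y \<in> {y \<in> arr_complement n UNIV. same_side n UNIV (?w p) y}"
    then have y: "y \<in> hyperspace n" "regular n y"
      and ss: "\<And>a b. (a, b) \<in> index_pairs n \<Longrightarrow> \<lfloor>?w p a - ?w p b\<rfloor> = \<lfloor>y a - y b\<rfloor>"
      unfolding arr_complement_UNIV same_side_UNIV by auto
    define q where "q = foldr (vec_refl n) (rev xs) y"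
    have xs': "rev xs \<in> lists {..<n}" by (rule rev_in_lists[OF xs])
    have wq: "?w q = y" unfolding q_def using foldr_rev_cancel[OF n xs', of y] by simp
    have qh: "q \<in> hyperspace n" "regular n q"
      unfolding q_def using foldr_hyperspace[OF n xs' y(1)] regular_foldr[OF n xs' y(2)] .
    have "q b < q a \<and> q a < q b + 1" if "1 \<le> a" "a < b" "b \<le> n" for a b
    proof -
      obtain a' where a': "a = \<pi> a'" using surjD[OF permutes_surj[OF \<pi>]] by blast
      obtain b' where b': "b = \<pi> b'" using surjD[OF permutes_surj[OF \<pi>]] by blast
      note ab' = a' b'
      have m: "a' \<in> {1..n}" "b' \<in> {1..n}" "a' \<noteq> b'"
        using that ab' im[of a'] im[of b'] by auto
      have "\<lfloor>?w p a' - ?w p b'\<rfloor> = \<lfloor>?w q a' - ?w q b'\<rfloor>"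
        using floors_pairs_all[OF regular_foldr[OF n xs reg[OF p]] y(2) ss m] unfolding wq .
      then have "\<lfloor>q a - q b\<rfloor> = \<lfloor>p a - p b\<rfloor>" unfolding fl ab' by simp
      also have "\<dots> = 0" using f0[OF p] that by (simp add: index_pairs_def)
      finally have "0 \<le> q a - q b" "q a - q b < 1" by linarith+
      moreover have "q a - q b \<noteq> 0"
      proof -
        have "a \<in> {1..n}" "b \<in> {1..n}" "a \<noteq> b" using that by auto
        then have "q a - q b \<notin> \<int>" using qh(2) unfolding regular_def by blast
        then show ?thesis by auto
      qed
      ultimately show ?thesis by linarith
    qed
    then have "q \<in> fundamental_alcove n" using fundamental_alcove_iff[OF n, of q] qh by blast
    then show "y \<in> ?w ` fundamental_alcove n" using wq by (metis image_eqI)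
  qed
qed

lemma alcove_in_alcoves:
  assumes n: "n \<ge> 2" and xs: "xs \<in> lists {..<n}" and p: "p \<in> fundamental_alcove n"
  shows "foldr (vec_refl n) xs ` fundamental_alcove n \<in> alcoves n"
proof -
  have "p \<in> hyperspace n" using p by (simp add: fundamental_alcove_def)
  then have "foldr (vec_refl n) xs p \<in> arr_complement n UNIV"
    unfolding arr_complement_UNIV
    using foldr_hyperspace[OF n xs] regular_foldr[OF n xs fundamental_regular[OF n p]] by simp
  then show ?thesis
    unfolding alcove_points[OF assms] alcoves_def arr_complement_eq[of n UNIV, simplified]
      components_arr_complement by blast
qed

lemma shi_regions_eq:
  "shi_regions n m = (\<lambda>x. {y \<in> arr_complement n {- int m<..int m}. same_side n {- int m<..int m} x y})
      ` arr_complement n {- int m<..int m}"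
  unfolding shi_regions_def arr_complement_eq components_arr_complement ..

lemma alcove_subset_region:
  assumes n: "n \<ge> 2" and xs: "xs \<in> lists {..<n}" and p: "p \<in> fundamental_alcove n"
    and R: "R \<in> shi_regions n m"
  shows "foldr (vec_refl n) xs ` fundamental_alcove n \<subseteq> R \<longleftrightarrow> foldr (vec_refl n) xs p \<in> R"
proof
  assume "foldr (vec_refl n) xs ` fundamental_alcove n \<subseteq> R"
  then show "foldr (vec_refl n) xs p \<in> R" using p by blast
next
  let ?K = "{- int m<..int m}"
  assume x: "foldr (vec_refl n) xs p \<in> R"
  obtain z where z: "R = {y \<in> arr_complement n ?K. same_side n ?K z y}"
    using R unfolding shi_regions_eq by blast
  show "foldr (vec_refl n) xs ` fundamental_alcove n \<subseteq> R"
  proof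
    fix y assume "y \<in> foldr (vec_refl n) xs ` fundamental_alcove n"
    then have y: "y \<in> arr_complement n UNIV" "same_side n UNIV (foldr (vec_refl n) xs p) y"
      unfolding alcove_points[OF n xs p] by auto
    have "y \<in> arr_complement n ?K"
      using y(1) regular_arr_complement unfolding arr_complement_UNIV by blast
    moreover have "same_side n ?K z (foldr (vec_refl n) xs p)" using x unfolding z by blast
    with y(2) have "same_side n ?K z y" unfolding same_side_def by fast
    ultimately show "y \<in> R" unfolding z by blast
  qed
qed

section \<open>Partitions, beads and cores\<close>

definition partition_rows :: "(nat \<Rightarrow> nat) \<Rightarrow> bool" where
  "partition_rows \<rho> \<longleftrightarrow> antimono \<rho> \<and> (\<exists>N. \<forall>i\<ge>N. \<rho> i = 0)"

definition diag :: "(nat \<Rightarrow> nat) \<Rightarrow> diagram" where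
  "diag \<rho> = {(Suc i, Suc j) | i j. j < \<rho> i}"

text \<open>
  Rows are counted from 0, so the empty partition has the beads \<open>0, -1, -2, \<dots>\<close>, and removing the last
  box of a row moves its bead from \<open>k + 1\<close> to \<open>k\<close>, where \<open>k\<close> is the content of the box.
\<close>
definition bead :: "(nat \<Rightarrow> nat) \<Rightarrow> nat \<Rightarrow> int" where
  "bead \<rho> i = int (\<rho> i) - int i"

lemma mem_diag [simp]: "(Suc i, Suc j) \<in> diag \<rho> \<longleftrightarrow> j < \<rho> i"
  by (auto simp: diag_def)

lemma diagE: assumes "b \<in> diag \<rho>" obtains i j where "b = (Suc i, Suc j)" "j < \<rho> i"
  using assms by (auto simp: diag_def)

lemma diag_eqI:
  assumes "\<And>q. q \<in> D \<Longrightarrow> \<exists>a c. q = (Suc a, Suc c)" "\<And>a c. (Suc a, Suc c) \<in> D \<longleftrightarrow> c < \<rho> a"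
  shows "D = diag \<rho>"
  using assms unfolding diag_def by blast

lemma partition_rows_antimono: "partition_rows \<rho> \<Longrightarrow> i \<le> j \<Longrightarrow> \<rho> j \<le> \<rho> i"
  unfolding partition_rows_def by (blast dest: antimonoD)

lemma partition_rowsI:
  assumes "\<And>i. \<rho> (Suc i) \<le> \<rho> i" "\<And>i. i \<ge> N \<Longrightarrow> \<rho> i = 0"
  shows "partition_rows \<rho>"
  using assms decseq_SucI[of \<rho>] unfolding partition_rows_def by blast

lemma is_partition_iff: "is_partition D \<longleftrightarrow> (\<exists>\<rho>. partition_rows \<rho> \<and> D = diag \<rho>)"
proof
  assume "is_partition D"
  then obtain p where p: "sorted_wrt (\<ge>) p" "D = young_diagram p"
    unfolding is_partition_def by blast
  let ?r = "\<lambda>i. if i < length p then p ! i else 0"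
  have "partition_rows ?r"
    using p(1) by (intro partition_rowsI[of _ "length p"]) (auto simp: sorted_wrt_iff_nth_less)
  moreover have "D = diag ?r"
  proof (intro equalityI subsetI)
    fix b assume "b \<in> D"
    then obtain i j where "b = (i, j)" "1 \<le> i" "i \<le> length p" "1 \<le> j" "j \<le> p ! (i - 1)"
      unfolding p(2) young_diagram_def by blast
    then show "b \<in> diag ?r" by (cases i; cases j) auto
  next
    fix b assume "b \<in> diag ?r"
    then obtain i j where ij: "b = (Suc i, Suc j)" "j < ?r i" by (rule diagE)
    then have "i < length p" by (cases "i < length p") auto
    then show "b \<in> D" using ij by (simp add: p(2) young_diagram_def)
  qed
  ultimately show "\<exists>\<rho>. partition_rows \<rho> \<and> D = diag \<rho>" by blast
next
  assume "\<exists>\<rho>. partition_rows \<rho> \<and> D = diag \<rho>"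
  then obtain \<rho> where \<rho>: "partition_rows \<rho>" "D = diag \<rho>" by blast
  then obtain M where "\<rho> M = 0" unfolding partition_rows_def by blast
  define N where "N = (LEAST i. \<rho> i = 0)"
  have "\<rho> N = 0" unfolding N_def by (rule LeastI[of "\<lambda>i. \<rho> i = 0", OF \<open>\<rho> M = 0\<close>])
  then have z: "\<rho> i = 0" if "i \<ge> N" for i using partition_rows_antimono[OF \<rho>(1) that] by simp
  have pos: "\<rho> i > 0" if "i < N" for i using not_less_Least[of i "\<lambda>i. \<rho> i = 0"] that by (simp add: N_def)
  let ?p = "map \<rho> [0..<N]"
  have "sorted_wrt (\<ge>) ?p"
    using partition_rows_antimono[OF \<rho>(1)] by (auto simp: sorted_wrt_iff_nth_less)
  moreover have "\<forall>x\<in>set ?p. x > 0" using pos by auto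
  moreover have "D = young_diagram ?p"
  proof (intro equalityI subsetI)
    fix b assume "b \<in> D"
    then obtain i j where ij: "b = (Suc i, Suc j)" "j < \<rho> i" unfolding \<rho>(2) by (rule diagE)
    then have "i < N" using z[of i] by (cases "i < N") auto
    then show "b \<in> young_diagram ?p" using ij by (simp add: young_diagram_def)
  next
    fix b assume "b \<in> young_diagram ?p"
    then obtain i j where "b = (i, j)" "1 \<le> i" "i \<le> N" "1 \<le> j" "j \<le> ?p ! (i - 1)"
      unfolding young_diagram_def by auto
    then show "b \<in> D" unfolding \<rho>(2) by (cases i; cases j) auto
  qed
  ultimately show "is_partition D" unfolding is_partition_def by blast
qed

lemma bead_strict:
  assumes "partition_rows \<rho>" "i < j" shows "bead \<rho> j < bead \<rho> i"
  using partition_rows_antimono[OF assms(1), of i j] assms(2) by (simp add: bead_def)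

lemma bead_less_iff:
  assumes "partition_rows \<rho>" shows "bead \<rho> j < bead \<rho> i \<longleftrightarrow> i < j"
proof (cases i j rule: linorder_cases)
  case less
  then show ?thesis using bead_strict[OF assms less] by simp
next
  case greater
  then show ?thesis using bead_strict[OF assms greater] by simp
qed simp

lemma bead_inj:
  assumes "partition_rows \<rho>" shows "bead \<rho> i = bead \<rho> j \<longleftrightarrow> i = j"
  using bead_less_iff[OF assms, of i j] bead_less_iff[OF assms, of j i]
  by (metis less_irrefl linorder_less_linear)

lemma bead_below:
  assumes "partition_rows \<rho>" shows "bead \<rho> i - 1 \<in> range (bead \<rho>) \<longleftrightarrow> \<rho> (Suc i) = \<rho> i"
proof
  assume "bead \<rho> i - 1 \<in> range (bead \<rho>)"
  then obtain j where j: "bead \<rho> j = bead \<rho> i - 1" by auto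
  then have "i < j" using bead_less_iff[OF assms, of j i] by simp
  then have "bead \<rho> j \<le> bead \<rho> (Suc i)"
    using bead_strict[OF assms, of "Suc i" j] by (cases "j = Suc i") auto
  then have "\<rho> i \<le> \<rho> (Suc i)" unfolding j by (simp add: bead_def)
  then show "\<rho> (Suc i) = \<rho> i" using partition_rows_antimono[OF assms, of i "Suc i"] by simp
next
  assume "\<rho> (Suc i) = \<rho> i"
  then have "bead \<rho> i - 1 = bead \<rho> (Suc i)" by (simp add: bead_def)
  then show "bead \<rho> i - 1 \<in> range (bead \<rho>)" by simp
qed

lemma bead_above:
  assumes "partition_rows \<rho>"
  shows "bead \<rho> i + 1 \<in> range (bead \<rho>) \<longleftrightarrow> (\<exists>j. i = Suc j \<and> \<rho> j = \<rho> i)"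
proof
  assume "bead \<rho> i + 1 \<in> range (bead \<rho>)"
  then obtain j where j: "bead \<rho> j = bead \<rho> i + 1" by auto
  then have "bead \<rho> j - 1 \<in> range (bead \<rho>)" by simp
  then have r: "\<rho> (Suc j) = \<rho> j" using bead_below[OF assms] by blast
  then have "bead \<rho> (Suc j) = bead \<rho> i" using j by (simp add: bead_def)
  then have "i = Suc j" using bead_inj[OF assms, of "Suc j" i] by simp
  then show "\<exists>j. i = Suc j \<and> \<rho> j = \<rho> i" using r by simp
next
  assume "\<exists>j. i = Suc j \<and> \<rho> j = \<rho> i"
  then obtain j where "i = Suc j" "\<rho> i = \<rho> j" by metis
  then have "bead \<rho> i + 1 = bead \<rho> j" unfolding bead_def by linarith
  then show "bead \<rho> i + 1 \<in> range (bead \<rho>)" by simp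
qed

lemma bead_range_eq:
  assumes \<rho>: "partition_rows \<rho>" and \<rho>': "partition_rows \<rho>'"
    and eq: "range (bead \<rho>) = range (bead \<rho>')"
  shows "\<rho> = \<rho>'"
proof -
  have le: "bead r i \<le> bead r' i"
    if r: "partition_rows r" "partition_rows r'" "range (bead r) = range (bead r')"
      and eq: "\<And>j. j < i \<Longrightarrow> bead r j = bead r' j" for r r' i
  proof -
    obtain j where j: "bead r i = bead r' j" using r(3) by blast
    have "\<not> j < i"
    proof
      assume "j < i"
      then have "bead r i < bead r j" using bead_strict[OF r(1)] by blast
      then show False using eq[OF \<open>j < i\<close>] j by simp
    qed
    then show ?thesis using bead_strict[OF r(2), of i j] j by (cases "i = j") auto
  qed
  have "bead \<rho> i = bead \<rho>' i" for i
  proof (induction i rule: less_induct)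
    case (less i)
    show ?case
    proof (rule antisym)
      show "bead \<rho> i \<le> bead \<rho>' i" by (rule le[OF \<rho> \<rho>' eq less])
      show "bead \<rho>' i \<le> bead \<rho> i" by (rule le[OF \<rho>' \<rho> eq[symmetric] less[symmetric]])
    qed
  qed
  then show ?thesis by (auto simp: bead_def)
qed

lemma residue_Suc: "residue n (Suc i, Suc j) = (int j - int i) mod int n"
  by (simp add: residue_def)

lemma removable_diag:
  assumes \<rho>: "partition_rows \<rho>"
  shows "removable_boxes n (diag \<rho>) r =
    {(Suc i, \<rho> i) | i. bead \<rho> i - 1 \<notin> range (bead \<rho>) \<and> (bead \<rho> i - 1) mod int n = r}"
proof (intro equalityI subsetI)
  fix b assume "b \<in> removable_boxes n (diag \<rho>) r"
  then have b: "b \<in> diag \<rho>" "is_partition (diag \<rho> - {b})" "residue n b = r"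
    by (auto simp: removable_boxes_def)
  obtain i j where ij: "b = (Suc i, Suc j)" "j < \<rho> i" using b(1) by (rule diagE)
  obtain \<rho>' where \<rho>': "partition_rows \<rho>'" "diag \<rho> - {b} = diag \<rho>'"
    using b(2) is_partition_iff by blast
  have mem: "c < \<rho>' a \<longleftrightarrow> c < \<rho> a \<and> \<not> (a = i \<and> c = j)" for a c
    using \<rho>'(2)[THEN eqset_imp_iff, of "(Suc a, Suc c)"] ij by simp
  have "\<not> Suc j < \<rho> i"
  proof
    assume "Suc j < \<rho> i"
    then have "Suc j < \<rho>' i" using mem[of "Suc j" i] by simp
    then show False using mem[of j i] by simp
  qed
  then have j: "\<rho> i = Suc j" using ij(2) by simp
  have "\<rho> (Suc i) \<noteq> \<rho> i"
  proof
    assume "\<rho> (Suc i) = \<rho> i"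
    then have "j < \<rho>' (Suc i)" using mem[of j "Suc i"] ij(2) by simp
    then have "j < \<rho>' i" using partition_rows_antimono[OF \<rho>'(1), of i "Suc i"] by simp
    then show False using mem[of j i] by simp
  qed
  then have "bead \<rho> i - 1 \<notin> range (bead \<rho>)" using bead_below[OF \<rho>] by blast
  moreover have "(bead \<rho> i - 1) mod int n = r"
    using b(3) unfolding ij(1) residue_Suc by (simp add: bead_def j algebra_simps)
  ultimately show "b \<in> {(Suc i, \<rho> i) | i. bead \<rho> i - 1 \<notin> range (bead \<rho>) \<and> (bead \<rho> i - 1) mod int n = r}"
    unfolding ij(1) using j by auto
next
  fix b assume "b \<in> {(Suc i, \<rho> i) | i. bead \<rho> i - 1 \<notin> range (bead \<rho>) \<and> (bead \<rho> i - 1) mod int n = r}"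
  then obtain i where i: "b = (Suc i, \<rho> i)" "bead \<rho> i - 1 \<notin> range (bead \<rho>)" "(bead \<rho> i - 1) mod int n = r"
    by blast
  have "\<rho> (Suc i) \<noteq> \<rho> i" using i(2) bead_below[OF \<rho>] by blast
  then have lt: "\<rho> (Suc i) < \<rho> i" using partition_rows_antimono[OF \<rho>, of i "Suc i"] by simp
  then obtain j where j: "\<rho> i = Suc j" by (cases "\<rho> i") auto
  let ?r = "\<rho>(i := j)"
  obtain N where N: "\<And>k. k \<ge> N \<Longrightarrow> \<rho> k = 0" using \<rho> unfolding partition_rows_def by blast
  have "partition_rows ?r"
  proof (rule partition_rowsI[of _ N])
    show "?r (Suc k) \<le> ?r k" for k
      using partition_rows_antimono[OF \<rho>, of k "Suc k"] lt j by auto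
    show "?r k = 0" if "k \<ge> N" for k using N[OF that] j by auto
  qed
  moreover have "diag \<rho> - {b} = diag ?r"
    by (rule diag_eqI) (auto simp: i(1) j elim!: diagE)
  ultimately have "is_partition (diag \<rho> - {b})" unfolding is_partition_iff by blast
  moreover have "residue n b = r" using i(3) unfolding i(1) j residue_Suc by (simp add: bead_def j algebra_simps)
  moreover have "b \<in> diag \<rho>" unfolding i(1) j by (simp add: j)
  ultimately show "b \<in> removable_boxes n (diag \<rho>) r" by (simp add: removable_boxes_def)
qed

lemma addable_diag:
  assumes \<rho>: "partition_rows \<rho>"
  shows "addable_boxes n (diag \<rho>) r =
    {(Suc i, Suc (\<rho> i)) | i. bead \<rho> i + 1 \<notin> range (bead \<rho>) \<and> bead \<rho> i mod int n = r}"
proof (intro equalityI subsetI)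
  fix b assume "b \<in> addable_boxes n (diag \<rho>) r"
  then have b: "b \<notin> diag \<rho>" "is_partition (insert b (diag \<rho>))" "residue n b = r"
    by (auto simp: addable_boxes_def)
  obtain \<rho>' where \<rho>': "partition_rows \<rho>'" "insert b (diag \<rho>) = diag \<rho>'"
    using b(2) is_partition_iff by blast
  then have "b \<in> diag \<rho>'" by blast
  then obtain i j where ij: "b = (Suc i, Suc j)" "j < \<rho>' i" by (rule diagE)
  have mem: "c < \<rho>' a \<longleftrightarrow> c < \<rho> a \<or> a = i \<and> c = j" for a c
    using \<rho>'(2)[THEN eqset_imp_iff, of "(Suc a, Suc c)"] ij by auto
  have "\<not> j < \<rho> i" using b(1) ij by simp
  moreover have "\<not> \<rho> i < j"
  proof
    assume "\<rho> i < j"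
    then have "\<rho> i < \<rho>' i" using ij(2) by simp
    then show False using mem[of "\<rho> i" i] \<open>\<rho> i < j\<close> by simp
  qed
  ultimately have j: "j = \<rho> i" by simp
  have "\<not> (\<exists>k. i = Suc k \<and> \<rho> k = \<rho> i)"
  proof
    assume "\<exists>k. i = Suc k \<and> \<rho> k = \<rho> i"
    then obtain k where k: "i = Suc k" "\<rho> k = \<rho> i" by blast
    have "j < \<rho>' k" using partition_rows_antimono[OF \<rho>'(1), of k i] ij(2) k(1) by simp
    then show False using mem[of j k] k j by simp
  qed
  then have "bead \<rho> i + 1 \<notin> range (bead \<rho>)" using bead_above[OF \<rho>] by blast
  moreover have "bead \<rho> i mod int n = r"
    using b(3) unfolding ij(1) residue_Suc by (simp add: bead_def j)
  ultimately show "b \<in> {(Suc i, Suc (\<rho> i)) | i. bead \<rho> i + 1 \<notin> range (bead \<rho>) \<and> bead \<rho> i mod int n = r}"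
    unfolding ij(1) using j by auto
next
  fix b assume "b \<in> {(Suc i, Suc (\<rho> i)) | i. bead \<rho> i + 1 \<notin> range (bead \<rho>) \<and> bead \<rho> i mod int n = r}"
  then obtain i where i: "b = (Suc i, Suc (\<rho> i))" "bead \<rho> i + 1 \<notin> range (bead \<rho>)" "bead \<rho> i mod int n = r"
    by blast
  have ne: "\<not> (i = Suc k \<and> \<rho> k = \<rho> i)" for k using i(2) bead_above[OF \<rho>] by blast
  let ?r = "\<rho>(i := Suc (\<rho> i))"
  obtain N where N: "\<And>k. k \<ge> N \<Longrightarrow> \<rho> k = 0" using \<rho> unfolding partition_rows_def by blast
  have "partition_rows ?r"
  proof (rule partition_rowsI[of _ "max N (Suc i)"])
    show "?r (Suc k) \<le> ?r k" for k
      using partition_rows_antimono[OF \<rho>, of k "Suc k"] ne[of k] by auto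
    show "?r k = 0" if "k \<ge> max N (Suc i)" for k using N[of k] that by auto
  qed
  moreover have "insert b (diag \<rho>) = diag ?r"
    by (rule diag_eqI) (auto simp: i(1) elim!: diagE)
  ultimately have "is_partition (insert b (diag \<rho>))" unfolding is_partition_iff by metis
  moreover have "residue n b = r" using i(3) unfolding i(1) residue_Suc by (simp add: bead_def)
  moreover have "b \<notin> diag \<rho>" unfolding i(1) by simp
  ultimately show "b \<in> addable_boxes n (diag \<rho>) r" by (simp add: addable_boxes_def)
qed

text \<open>
  Every runner of the abacus is filled up to the height given by the vector.  Hence, if one pair of
  positions \<open>k, k + 1\<close> with \<open>k \<equiv> i\<close> consists of a bead followed by a gap, no such pair consists of a
  gap followed by a bead; moving all beads that can move up therefore exchanges the two runners.
\<close>
lemma core_refl_beads: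
  assumes n: "n \<ge> 2" and i: "i < n" and \<rho>: "partition_rows \<rho>"
    and beads: "range (bead \<rho>) = {k. 0 < ext n (v :: vec) k}"
  shows "\<exists>\<rho>'. partition_rows \<rho>' \<and> core_refl n i (diag \<rho>) = diag \<rho>' \<and>
    range (bead \<rho>') = {k. 0 < ext n (vec_refl n i v) k}"
proof -
  define M where "M = range (bead \<rho>)"
  have n0: "n > 0" using n by simp
  have Mk: "k \<in> M \<longleftrightarrow> 0 < ext n v k" for k unfolding M_def beads by simp
  have target: "{k. 0 < ext n (vec_refl n i v) k} = {k. idx_refl n (int i) k \<in> M}"
    using ext_vec_refl[OF n i, of v] by (simp add: Mk)
  obtain N where N: "\<And>k. k \<ge> N \<Longrightarrow> \<rho> k = 0" using \<rho> unfolding partition_rows_def by blast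
  have res: "k mod int n = int i \<longleftrightarrow> [k = int i] (mod int n)" for k
    using i by (simp add: cong_def)
  have adj: "\<not> [k = int i] (mod int n)" if "[k = int i + 1] (mod int n)" for k
  proof
    assume "[k = int i] (mod int n)"
    then have "[int i + 1 = int i] (mod int n)" using that by (meson cong_sym cong_trans)
    then show False using not_cong_plus[of 1 n "int i"] n by simp
  qed
  have sh1: "[k - 1 = int i] (mod int n) \<longleftrightarrow> [k = int i + 1] (mod int n)" for k
    by (simp add: cong_iff_dvd_diff algebra_simps)
  have sh2: "[k + 1 = int i + 1] (mod int n) \<longleftrightarrow> [k = int i] (mod int n)" for k
    by (simp add: cong_iff_dvd_diff)
  note idx = idx_refl_def
  show ?thesis
  proof (cases "addable_boxes n (diag \<rho>) (int i) = {}")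
    case False
    then obtain a where a: "bead \<rho> a + 1 \<notin> M" "bead \<rho> a mod int n = int i"
      unfolding addable_diag[OF \<rho>] M_def by blast
    have down: "k \<in> M" if "k + 1 \<in> M" "[k = int i] (mod int n)" for k
    proof -
      have "[bead \<rho> a = k] (mod int n)" using a(2) that(2) i unfolding cong_def by simp
      then obtain t where t: "k = bead \<rho> a + int n * t" by (metis cong_iff_lin)
      have k1: "k + 1 = (bead \<rho> a + 1) + int n * t" using t by simp
      have "0 < ext n v (bead \<rho> a)" "\<not> 0 < ext n v (bead \<rho> a + 1)"
        using a(1) Mk M_def by blast+
      moreover have "0 < ext n v (k + 1)" using that(1) Mk by blast
      moreover have "ext n v k = ext n v (bead \<rho> a) - of_int t" unfolding t by (rule ext_shift[OF n0])
      moreover have "ext n v (k + 1) = ext n v (bead \<rho> a + 1) - of_int t"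
        unfolding k1 by (rule ext_shift[OF n0])
      ultimately show ?thesis unfolding Mk by linarith
    qed
    let ?c = "\<lambda>a. bead \<rho> a + 1 \<notin> M \<and> [bead \<rho> a = int i] (mod int n)"
    let ?r = "\<lambda>a. if ?c a then Suc (\<rho> a) else \<rho> a"
    have nc: "\<not> ?c (Suc k)" if "\<rho> (Suc k) = \<rho> k" for k
      using bead_above[OF \<rho>, of "Suc k"] that unfolding M_def by simp
    have r: "partition_rows ?r"
    proof (rule partition_rowsI[of _ "Suc N"])
      show "?r (Suc k) \<le> ?r k" for k
        using partition_rows_antimono[OF \<rho>, of k "Suc k"] nc[of k] by (cases "\<rho> (Suc k) = \<rho> k") auto
      show "?r k = 0" if "k \<ge> Suc N" for k
      proof -
        define l where "l = k - 1"
        have l: "k = Suc l" "l \<ge> N" using that by (auto simp: l_def)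
        then have "\<rho> l = 0" "\<rho> (Suc l) = 0" using N[of l] N[of "Suc l"] by auto
        then show ?thesis using nc[of l] l(1) by simp
      qed
    qed
    have "core_refl n i (diag \<rho>) = diag \<rho> \<union> addable_boxes n (diag \<rho>) (int i)"
      using False by (simp add: core_refl_def)
    also have "\<dots> = diag ?r"
    proof (intro Set.set_eqI iffI)
      fix q assume "q \<in> diag \<rho> \<union> addable_boxes n (diag \<rho>) (int i)"
      then show "q \<in> diag ?r"
        unfolding addable_diag[OF \<rho>] res M_def[symmetric] by (auto elim!: diagE)
    next
      fix q assume "q \<in> diag ?r"
      then obtain a j where q: "q = (Suc a, Suc j)" "j < ?r a" by (rule diagE)
      show "q \<in> diag \<rho> \<union> addable_boxes n (diag \<rho>) (int i)"
      proof (cases "j < \<rho> a")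
        case True then show ?thesis using q by simp
      next
        case False
        then have "?c a" "j = \<rho> a" using q(2) by (auto split: if_splits)
        then show ?thesis using q(1) unfolding addable_diag[OF \<rho>] res M_def[symmetric] by blast
      qed
    qed
    finally have core: "core_refl n i (diag \<rho>) = diag ?r" .
    have br: "bead ?r a = (if ?c a then bead \<rho> a + 1 else bead \<rho> a)" for a
      by (simp add: bead_def)
    have "range (bead ?r) = (\<lambda>b. if b + 1 \<notin> M \<and> [b = int i] (mod int n) then b + 1 else b) ` M"
      unfolding M_def image_image using br unfolding M_def by (intro image_cong) auto
    also have "\<dots> = {k. idx_refl n (int i) k \<in> M}"
    proof (intro Set.set_eqI iffI)
      fix k assume "k \<in> (\<lambda>b. if b + 1 \<notin> M \<and> [b = int i] (mod int n) then b + 1 else b) ` M"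
      then obtain b where b: "b \<in> M" "k = (if b + 1 \<notin> M \<and> [b = int i] (mod int n) then b + 1 else b)"
        by blast
      show "k \<in> {k. idx_refl n (int i) k \<in> M}"
      proof (cases "b + 1 \<notin> M \<and> [b = int i] (mod int n)")
        case True
        then have "k = b + 1" using b by simp
        then show ?thesis using True b adj[of "b + 1"] sh2[of b] by (simp add: idx)
      next
        case False
        then have kb: "k = b" using b by auto
        show ?thesis
          using False b adj[of b] down[of "b - 1"] sh1[of b] unfolding kb by (auto simp: idx)
      qed
    next
      fix k assume k: "k \<in> {k. idx_refl n (int i) k \<in> M}"
      consider "[k = int i] (mod int n)" | "[k = int i + 1] (mod int n)" |
        "\<not> [k = int i] (mod int n)" "\<not> [k = int i + 1] (mod int n)" by blast
      then show "k \<in> (\<lambda>b. if b + 1 \<notin> M \<and> [b = int i] (mod int n) then b + 1 else b) ` M"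
      proof cases
        case 1
        then have "k + 1 \<in> M" using k by (simp add: idx)
        then show ?thesis using down[OF _ 1] by (intro image_eqI[of _ _ k]) auto
      next
        case 2
        have "k - 1 \<in> M" using k adj[OF 2] 2 by (simp add: idx)
        show ?thesis
        proof (cases "k \<in> M")
          case True then show ?thesis using adj[OF 2] by (intro image_eqI[of _ _ k]) auto
        next
          case False
          then show ?thesis using \<open>k - 1 \<in> M\<close> sh1[of k] 2 by (intro image_eqI[of _ _ "k - 1"]) auto
        qed
      next
        case 3
        then have "k \<in> M" using k by (simp add: idx)
        then show ?thesis using 3 by (intro image_eqI[of _ _ k]) auto
      qed
    qed
    finally show ?thesis unfolding target using core r by blast
  next
    case True
    have up: "k + 1 \<in> M" if k: "k \<in> M" "[k = int i] (mod int n)" for k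
    proof (rule ccontr)
      assume *: "k + 1 \<notin> M"
      obtain a where "k = bead \<rho> a" using k(1) unfolding M_def by blast
      then have "(Suc a, Suc (\<rho> a)) \<in> addable_boxes n (diag \<rho>) (int i)"
        using * k(2) unfolding addable_diag[OF \<rho>] res M_def[symmetric] by blast
      then show False using True by blast
    qed
    let ?c = "\<lambda>a. bead \<rho> a - 1 \<notin> M \<and> [bead \<rho> a - 1 = int i] (mod int n)"
    let ?r = "\<lambda>a. if ?c a then \<rho> a - 1 else \<rho> a"
    have lt: "\<rho> (Suc a) < \<rho> a" if "?c a" for a
    proof -
      have "\<rho> (Suc a) \<noteq> \<rho> a" using bead_below[OF \<rho>, of a] that unfolding M_def by blast
      then show ?thesis using partition_rows_antimono[OF \<rho>, of a "Suc a"] by simp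
    qed
    have r: "partition_rows ?r"
    proof (rule partition_rowsI[of _ N])
      show "?r (Suc k) \<le> ?r k" for k
      proof -
        have "?r (Suc k) \<le> \<rho> (Suc k)" by simp
        also have "\<dots> \<le> ?r k" using partition_rows_antimono[OF \<rho>, of k "Suc k"] lt[of k] by auto
        finally show ?thesis .
      qed
      show "?r k = 0" if "k \<ge> N" for k using N[OF that] by simp
    qed
    have "core_refl n i (diag \<rho>) = diag \<rho> - removable_boxes n (diag \<rho>) (int i)"
      using True by (simp add: core_refl_def)
    also have "\<dots> = diag ?r"
    proof (intro Set.set_eqI iffI)
      fix q assume q: "q \<in> diag \<rho> - removable_boxes n (diag \<rho>) (int i)"
      then obtain a j where aj: "q = (Suc a, Suc j)" "j < \<rho> a" by (auto elim: diagE)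
      have "\<not> (?c a \<and> Suc j = \<rho> a)"
      proof
        assume c: "?c a \<and> Suc j = \<rho> a"
        then have "(Suc a, \<rho> a) \<in> removable_boxes n (diag \<rho>) (int i)"
          unfolding removable_diag[OF \<rho>] res M_def[symmetric] by blast
        then show False using q aj c by simp
      qed
      then show "q \<in> diag ?r" using aj by auto
    next
      fix q assume "q \<in> diag ?r"
      then obtain a j where q: "q = (Suc a, Suc j)" "j < ?r a" by (rule diagE)
      then have "j < \<rho> a" by (auto split: if_splits)
      moreover have "q \<notin> removable_boxes n (diag \<rho>) (int i)"
      proof
        assume "q \<in> removable_boxes n (diag \<rho>) (int i)"
        then have "?c a" "Suc j = \<rho> a"
          unfolding removable_diag[OF \<rho>] res M_def[symmetric] using q(1) by auto
        then show False using q(2) by auto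
      qed
      ultimately show "q \<in> diag \<rho> - removable_boxes n (diag \<rho>) (int i)" using q(1) by simp
    qed
    finally have core: "core_refl n i (diag \<rho>) = diag ?r" .
    have br: "bead ?r a = (if ?c a then bead \<rho> a - 1 else bead \<rho> a)" for a
      using lt[of a] by (auto simp: bead_def)
    have "range (bead ?r) = (\<lambda>b. if b - 1 \<notin> M \<and> [b - 1 = int i] (mod int n) then b - 1 else b) ` M"
      unfolding M_def image_image using br unfolding M_def by (intro image_cong) auto
    also have "\<dots> = {k. idx_refl n (int i) k \<in> M}"
    proof (intro Set.set_eqI iffI)
      fix k assume "k \<in> (\<lambda>b. if b - 1 \<notin> M \<and> [b - 1 = int i] (mod int n) then b - 1 else b) ` M"
      then obtain b where b: "b \<in> M" "k = (if b - 1 \<notin> M \<and> [b - 1 = int i] (mod int n) then b - 1 else b)"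
        by blast
      show "k \<in> {k. idx_refl n (int i) k \<in> M}"
      proof (cases "b - 1 \<notin> M \<and> [b - 1 = int i] (mod int n)")
        case True
        then have "k = b - 1" using b by simp
        then show ?thesis using True b by (simp add: idx)
      next
        case False
        then have kb: "k = b" using b by auto
        show ?thesis
          using False b adj[of b] up[of b] sh1[of b] unfolding kb by (auto simp: idx)
      qed
    next
      fix k assume k: "k \<in> {k. idx_refl n (int i) k \<in> M}"
      consider "[k = int i] (mod int n)" | "[k = int i + 1] (mod int n)" |
        "\<not> [k = int i] (mod int n)" "\<not> [k = int i + 1] (mod int n)" by blast
      then show "k \<in> (\<lambda>b. if b - 1 \<notin> M \<and> [b - 1 = int i] (mod int n) then b - 1 else b) ` M"
      proof cases
        case 1
        then have k1: "k + 1 \<in> M" using k by (simp add: idx)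
        show ?thesis
        proof (cases "k \<in> M")
          case True then show ?thesis using 1 adj[of k] sh1[of k] by (intro image_eqI[of _ _ k]) auto
        next
          case False
          then show ?thesis using k1 1 by (intro image_eqI[of _ _ "k + 1"]) auto
        qed
      next
        case 2
        have "k - 1 \<in> M" using k adj[OF 2] 2 by (simp add: idx)
        then show ?thesis using up[of "k - 1"] sh1[of k] 2 by (intro image_eqI[of _ _ k]) auto
      next
        case 3
        then have "k \<in> M" using k by (simp add: idx)
        then show ?thesis using 3 sh1[of k] by (intro image_eqI[of _ _ k]) auto
      qed
    qed
    finally show ?thesis unfolding target using core r by blast
  qed
qed

lemma core_of_word:
  assumes n: "n \<ge> 2" and "xs \<in> lists {..<n}"
  shows "\<exists>\<rho>. partition_rows \<rho> \<and> foldr (core_refl n) xs {} = diag \<rho> \<and>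
    range (bead \<rho>) = {k. 0 < ext n (foldr (vec_refl n) xs (\<lambda>_. 0)) k}"
  using assms(2)
proof (induction xs)
  case Nil
  have "range (bead (\<lambda>_. 0)) = {k. 0 < ext n (\<lambda>_. 0 :: real) k}"
  proof (intro Set.set_eqI iffI)
    fix k assume "k \<in> range (bead (\<lambda>_. 0))"
    then have "k - 1 < 0" by (auto simp: bead_def)
    then have "(k - 1) div int n < 0" using n by (simp add: pos_imp_zdiv_neg_iff)
    then show "k \<in> {k. 0 < ext n (\<lambda>_. 0 :: real) k}" by (simp add: ext_def)
  next
    fix k assume "k \<in> {k. 0 < ext n (\<lambda>_. 0 :: real) k}"
    then have "(k - 1) div int n < 0" by (simp add: ext_def)
    then have "k \<le> 0" using n by (simp add: pos_imp_zdiv_neg_iff)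
    then show "k \<in> range (bead (\<lambda>_. 0))" by (intro image_eqI[of _ _ "nat (- k)"]) (auto simp: bead_def)
  qed
  moreover have "partition_rows (\<lambda>_. 0)" by (rule partition_rowsI[of _ 0]) auto
  moreover have "diag (\<lambda>_. 0) = {}" by (auto simp: diag_def)
  ultimately show ?case by (intro exI[of _ "\<lambda>_. 0"]) simp
next
  case (Cons i xs)
  then obtain \<rho> where \<rho>: "partition_rows \<rho>" "foldr (core_refl n) xs {} = diag \<rho>"
    "range (bead \<rho>) = {k. 0 < ext n (foldr (vec_refl n) xs (\<lambda>_. 0)) k}" by auto
  have "i < n" using Cons by simp
  from core_refl_beads[OF n this \<rho>(1,3)] show ?case by (simp add: \<rho>(2))
qed

text \<open>
  The action on cores respects the Coxeter relations because the action on vectors does: equivalent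
  words move the origin to the same vector, which determines the beads and hence the partition.
\<close>
lemma core_of_class:
  assumes n: "n \<ge> 2" and xs: "xs \<in> lists {..<n}"
  shows "word_act (core_refl n) (word_rel n `` {xs}) {} = foldr (core_refl n) xs {}"
proof -
  have same: "foldr (core_refl n) ys {} = foldr (core_refl n) xs {}" if eq: "word_eq n xs ys" for ys
  proof -
    have ys: "ys \<in> lists {..<n}" using word_eq_lists[OF eq] by simp
    obtain \<rho> where \<rho>: "partition_rows \<rho>" "foldr (core_refl n) xs {} = diag \<rho>"
      "range (bead \<rho>) = {k. 0 < ext n (foldr (vec_refl n) xs (\<lambda>_. 0)) k}"
      using core_of_word[OF n xs] by blast
    obtain \<rho>' where \<rho>': "partition_rows \<rho>'" "foldr (core_refl n) ys {} = diag \<rho>'"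
      "range (bead \<rho>') = {k. 0 < ext n (foldr (vec_refl n) ys (\<lambda>_. 0)) k}"
      using core_of_word[OF n ys] by blast
    have "range (bead \<rho>) = range (bead \<rho>')"
      unfolding \<rho>(3) \<rho>'(3) vec_refl_word_eq[OF eq n] ..
    then show ?thesis using bead_range_eq[OF \<rho>(1) \<rho>'(1)] \<rho>(2) \<rho>'(2) by simp
  qed
  have "(\<lambda>ys. foldr (core_refl n) ys {}) ` (word_rel n `` {xs}) = {foldr (core_refl n) xs {}}"
  proof (intro equalityI subsetI)
    fix u assume "u \<in> (\<lambda>ys. foldr (core_refl n) ys {}) ` (word_rel n `` {xs})"
    then obtain ys where "word_eq n xs ys" "u = foldr (core_refl n) ys {}"
      by (auto simp: word_rel_def)
    then show "u \<in> {foldr (core_refl n) xs {}}" using same by simp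
  next
    fix u assume "u \<in> {foldr (core_refl n) xs {}}"
    then show "u \<in> (\<lambda>ys. foldr (core_refl n) ys {}) ` (word_rel n `` {xs})"
      using word_refl[OF xs] by (intro image_eqI[of _ _ xs]) (auto simp: word_rel_def)
  qed
  then show ?thesis by (simp add: word_act_def)
qed

text \<open>
  The removable boxes correspond to the gaps \<open>k\<close> of residue \<open>i\<close> with a bead at \<open>k + 1\<close>, which occupy
  the levels between the heights of the two runners.
\<close>
lemma card_removable:
  assumes n: "n > 0" and \<rho>: "partition_rows \<rho>" and i: "i < n"
    and beads: "range (bead \<rho>) = {k. 0 < ext n (c :: nat \<Rightarrow> int) k}"
  shows "card (removable_boxes n (diag \<rho>) (int i)) = nat (ext n c (int i + 1) - ext n c (int i))"
proof -
  define S where "S = {a. bead \<rho> a - 1 \<notin> range (bead \<rho>) \<and> (bead \<rho> a - 1) mod int n = int i}"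
  have "removable_boxes n (diag \<rho>) (int i) = (\<lambda>a. (Suc a, \<rho> a)) ` S"
    unfolding removable_diag[OF \<rho>] S_def by blast
  then have "card (removable_boxes n (diag \<rho>) (int i)) = card S"
    by (simp add: card_image inj_on_def)
  also have "card S = card ((\<lambda>a. bead \<rho> a - 1) ` S)"
    by (rule card_image[symmetric]) (auto simp: inj_on_def bead_inj[OF \<rho>])
  also have "(\<lambda>a. bead \<rho> a - 1) ` S = (\<lambda>t. int i + int n * t) ` {ext n c (int i)..<ext n c (int i + 1)}"
  proof (intro Set.set_eqI iffI)
    fix k assume "k \<in> (\<lambda>a. bead \<rho> a - 1) ` S"
    then have k: "k + 1 \<in> range (bead \<rho>)" "k \<notin> range (bead \<rho>)" "k mod int n = int i"
      unfolding S_def by auto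
    define t where "t = k div int n"
    have kt: "k = int i + int n * t" using k(3) unfolding t_def by (metis add.commute mult_div_mod_eq)
    have k1: "k + 1 = (int i + 1) + int n * t" using kt by simp
    have "0 < ext n c (int i + 1) - t" using k(1) ext_shift[OF n, of c "int i + 1" t] unfolding beads k1 by simp
    moreover have "\<not> 0 < ext n c (int i) - t" using k(2) ext_shift[OF n, of c "int i" t] unfolding beads kt by simp
    ultimately show "k \<in> (\<lambda>t. int i + int n * t) ` {ext n c (int i)..<ext n c (int i + 1)}"
      unfolding kt by (intro imageI) simp
  next
    fix k assume "k \<in> (\<lambda>t. int i + int n * t) ` {ext n c (int i)..<ext n c (int i + 1)}"
    then obtain t where t: "k = int i + int n * t" "ext n c (int i) \<le> t" "t < ext n c (int i + 1)"
      unfolding image_iff Bex_def atLeastLessThan_iff by blast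
    have k1: "k + 1 = (int i + 1) + int n * t" using t by simp
    have "k + 1 \<in> range (bead \<rho>)" using t(3) ext_shift[OF n, of c "int i + 1" t] unfolding beads k1 by simp
    then obtain a where a: "bead \<rho> a = k + 1" by auto
    have "k \<notin> range (bead \<rho>)" using t(2) ext_shift[OF n, of c "int i" t] unfolding beads t(1) by simp
    moreover have "k mod int n = int i" using i unfolding t(1) by simp
    moreover have "bead \<rho> a - 1 = k" using a by simp
    ultimately have "a \<in> S" unfolding S_def by simp
    then show "k \<in> (\<lambda>a. bead \<rho> a - 1) ` S" using a by (intro image_eqI[of _ _ a]) auto
  qed
  also have "card \<dots> = card {ext n c (int i)..<ext n c (int i + 1)}"
    using n by (intro card_image) (auto simp: inj_on_def)
  finally show ?thesis by simp
qed

text \<open>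
  The gap belonging to column \<open>j\<close> of length \<open>C\<close> is \<open>j + 1 - C\<close>: row \<open>a\<close> has a larger bead if it meets
  the column, and a smaller one otherwise.
\<close>
lemma hook_length_beads:
  assumes \<rho>: "partition_rows \<rho>" and b: "b \<in> diag \<rho>"
  shows "\<exists>a\<in>range (bead \<rho>). \<exists>g. g \<notin> range (bead \<rho>) \<and> int (hook_length (diag \<rho>) b) = a - g"
proof -
  obtain i j where ij: "b = (Suc i, Suc j)" "j < \<rho> i" using b by (rule diagE)
  obtain N where "\<rho> N = 0" using \<rho> unfolding partition_rows_def by blast
  then have N: "\<not> j < \<rho> N" by simp
  define C where "C = (LEAST a. \<not> j < \<rho> a)"
  have "\<not> j < \<rho> C" unfolding C_def by (rule LeastI[of "\<lambda>a. \<not> j < \<rho> a", OF N])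
  then have C: "j < \<rho> a \<longleftrightarrow> a < C" for a
    using not_less_Least[of a "\<lambda>a. \<not> j < \<rho> a"] partition_rows_antimono[OF \<rho>, of C a]
    unfolding C_def[symmetric] by (cases "a < C") auto
  have iC: "i < C" using C ij(2) by blast
  let ?arm = "(\<lambda>c. (Suc i, Suc c)) ` {j..<\<rho> i}" and ?leg = "(\<lambda>a. (Suc a, Suc j)) ` {Suc i..<C}"
  have "{(x, y) \<in> diag \<rho>. x = fst b \<and> y \<ge> snd b \<or> y = snd b \<and> x \<ge> fst b} = ?arm \<union> ?leg"
  proof (intro Set.set_eqI iffI)
    fix q assume "q \<in> {(x, y) \<in> diag \<rho>. x = fst b \<and> y \<ge> snd b \<or> y = snd b \<and> x \<ge> fst b}"
    then have q: "q \<in> diag \<rho>" "fst q = fst b \<and> snd q \<ge> snd b \<or> snd q = snd b \<and> fst q \<ge> fst b" by auto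
    obtain a c where ac: "q = (Suc a, Suc c)" "c < \<rho> a" using q(1) by (rule diagE)
    have "a = i \<and> j \<le> c \<or> c = j \<and> i < a" using q(2) ac(1) ij(1) by auto
    then show "q \<in> ?arm \<union> ?leg" using ac C[of a] by auto
  next
    fix q assume "q \<in> ?arm \<union> ?leg"
    then consider c where "q = (Suc i, Suc c)" "j \<le> c" "c < \<rho> i"
      | a where "q = (Suc a, Suc j)" "i < a" "j < \<rho> a" using C by auto
    then show "q \<in> {(x, y) \<in> diag \<rho>. x = fst b \<and> y \<ge> snd b \<or> y = snd b \<and> x \<ge> fst b}"
      by cases (simp_all add: ij)
  qed
  then have "hook_length (diag \<rho>) b = card (?arm \<union> ?leg)" unfolding hook_length_def by simp
  also have "\<dots> = card ?arm + card ?leg" by (rule card_Un_disjoint) auto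
  also have "\<dots> = (\<rho> i - j) + (C - Suc i)" by (simp add: card_image inj_on_def)
  finally have "int (hook_length (diag \<rho>) b) = bead \<rho> i - (int j + 1 - int C)"
    using ij(2) iC by (simp add: bead_def)
  moreover have "int j + 1 - int C \<notin> range (bead \<rho>)"
  proof
    assume "int j + 1 - int C \<in> range (bead \<rho>)"
    then obtain a where a: "bead \<rho> a = int j + 1 - int C" by auto
    show False using C[of a] a by (cases "a < C") (auto simp: bead_def)
  qed
  ultimately show ?thesis by blast
qed

lemma core_of_bead_shift:
  assumes \<rho>: "partition_rows \<rho>" and t: "t > 0"
    and shift: "\<And>k. k \<in> range (bead \<rho>) \<Longrightarrow> k - int t \<in> range (bead \<rho>)"
  shows "is_core t (diag \<rho>)"
  unfolding is_core_def
proof (intro conjI ballI notI)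
  show "is_partition (diag \<rho>)" using \<rho> is_partition_iff by blast
  fix b assume b: "b \<in> diag \<rho>" "t dvd hook_length (diag \<rho>) b"
  obtain a g where ag: "a \<in> range (bead \<rho>)" "g \<notin> range (bead \<rho>)"
    "int (hook_length (diag \<rho>) b) = a - g" using hook_length_beads[OF \<rho> b(1)] by blast
  obtain q where "hook_length (diag \<rho>) b = t * q" using b(2) by blast
  then have g: "g = a - int t * int q" using ag(3) by simp
  have "a - int t * int q \<in> range (bead \<rho>)" for q :: nat
  proof (induction q)
    case (Suc q)
    from shift[OF Suc] show ?case by (simp add: algebra_simps)
  qed (use ag(1) in simp)
  then show False using ag(2) g by blast
qed

section \<open>Comparing alcoves within a Shi region\<close>

text \<open>
  Consecutive coordinates differ by \<open>1 / n\<close>, and so do the last and the first modulo 1, so that the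
  periodic extension is affine in the index.
\<close>
definition base_point :: "nat \<Rightarrow> vec" where
  "base_point n = (\<lambda>a. if a \<in> {1..n} then (real n + 1) / (2 * real n) - real a / real n else 0)"

lemma base_point_fundamental:
  assumes n: "n \<ge> 2"
  shows "base_point n \<in> fundamental_alcove n"
proof -
  have "2 * (\<Sum>a=1..n. real a) = real n * (real n + 1)"
    by (induction n) (simp_all add: algebra_simps)
  then have S: "(\<Sum>a=1..n. real a) = real n * (real n + 1) / 2" by simp
  have "(\<Sum>a=1..n. base_point n a) = (\<Sum>a=1..n. (real n + 1) / (2 * real n) - real a / real n)"
    by (rule sum.cong) (auto simp: base_point_def)
  also have "\<dots> = real n * ((real n + 1) / (2 * real n)) - (\<Sum>a=1..n. real a) / real n"
    by (simp add: sum_subtractf sum_divide_distrib)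
  also have "\<dots> = 0" using n unfolding S by (simp add: field_simps)
  finally have "base_point n \<in> hyperspace n" by (auto simp: hyperspace_def base_point_def)
  moreover have "base_point n b < base_point n a \<and> base_point n a < base_point n b + 1"
    if "1 \<le> a" "a < b" "b \<le> n" for a b
  proof -
    have "base_point n a - base_point n b = (real b - real a) / real n"
      using that by (simp add: base_point_def diff_divide_distrib)
    moreover have "0 < (real b - real a) / real n" "(real b - real a) / real n < 1"
      using that by simp_all
    ultimately show ?thesis by linarith
  qed
  ultimately show ?thesis using fundamental_alcove_iff[OF n] by blast
qed

definition window_res :: "nat \<Rightarrow> int \<Rightarrow> nat" where
  "window_res n k = nat ((k - 1) mod int n) + 1"

lemma window_res_range: "n > 0 \<Longrightarrow> window_res n k \<in> {1..n}"
proof -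
  assume n: "n > 0"
  then have "(k - 1) mod int n < int n" "0 \<le> (k - 1) mod int n" by simp_all
  then show ?thesis unfolding window_res_def by (simp add: nat_less_iff Suc_le_eq)
qed

lemma window_res_nat:
  assumes "a \<in> {1..n}" shows "window_res n (int a) = a" "window_res n (int a + int n) = a"
proof -
  have "(int a - 1) mod int n = int a - 1" using assms by simp
  moreover have "(int a + int n - 1) mod int n = (int a - 1) mod int n"
    by (metis add.commute add_diff_eq mod_add_self1)
  ultimately show "window_res n (int a) = a" "window_res n (int a + int n) = a"
    using assms unfolding window_res_def by auto
qed

lemma base_point_ext:
  assumes n: "n > 0"
  shows "base_point n (window_res n k) - of_int (c (window_res n k))
    = (real n + 1) / (2 * real n) - of_int k / real n - of_int (ext n c k)"
proof -
  let ?q = "(k - 1) div int n"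
  have "(k - 1) mod int n \<ge> 0" using n by simp
  then have "int (window_res n k) = k - int n * ?q"
    using mult_div_mod_eq[of "int n" "k - 1"] unfolding window_res_def by linarith
  then have "real (window_res n k) = of_int k - real n * of_int ?q"
    by (metis of_int_diff of_int_mult of_int_of_nat_eq)
  then have "real (window_res n k) / real n = of_int k / real n - of_int ?q"
    using n by (simp add: diff_divide_distrib)
  moreover have "c (window_res n k) = ext n c k + ?q" by (simp add: ext_def window_res_def)
  ultimately show ?thesis
    using window_res_range[OF n, of k] by (simp add: base_point_def)
qed

text \<open>
  The index \<open>\<tau> (window_res n s)\<close> is the coordinate of \<open>x\<close> that carries the residue \<open>s\<close>.
\<close>
lemma point_differences:
  assumes n: "n > 0" and perm: "\<sigma> permutes {1..n}"
    and x: "x = (\<lambda>a. base_point n (\<sigma> a) - of_int (c (\<sigma> a)))"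
    and \<tau>: "\<And>u. \<sigma> (\<tau> u) = u"
  shows "x (\<tau> (window_res n s)) - x (\<tau> (window_res n t))
    = of_int (t - s) / real n + of_int (ext n c t - ext n c s)"
proof -
  have "x (\<tau> (window_res n k)) = (real n + 1) / (2 * real n) - of_int k / real n - of_int (ext n c k)" for k
    unfolding x \<tau> by (rule base_point_ext[OF n])
  then show ?thesis by (simp add: diff_divide_distrib)
qed

text \<open>
  Take residues \<open>s < t < s + n\<close> with \<open>x\<close> larger at \<open>s\<close>.  The floor of the difference is the
  increment of the charge from \<open>s\<close> to \<open>t\<close>, which is additive.  If it is at most \<open>m\<close>, the bound for \<open>y\<close>
  comes from a hyperplane of the arrangement.  Otherwise some residue between \<open>s\<close> and \<open>t\<close> has an
  intermediate value of \<open>x\<close>, and the bounds for the two parts add up: a sequence that jumps over the whole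
  gap at once would need a step larger than \<open>m\<close>.
\<close>
lemma dominant_floor_le:
  assumes n: "n \<ge> 2" and m: "m \<ge> 1" and perm: "\<sigma> permutes {1..n}"
    and x: "x = (\<lambda>a. base_point n (\<sigma> a) - of_int (c (\<sigma> a)))"
    and dom: "\<And>a b. (a, b) \<in> index_pairs n \<Longrightarrow> x b < x a"
    and step: "\<And>k. ext n c (k + 1) - ext n c k \<le> int m"
    and same: "same_side n {- int m<..int m} x y"
    and ab: "(a, b) \<in> index_pairs n"
  shows "\<lfloor>x a - x b\<rfloor> \<le> \<lfloor>y a - y b\<rfloor>"
proof -
  have n0: "n > 0" using n by simp
  define \<tau> where "\<tau> = inv_into UNIV \<sigma>"
  have \<tau>: "\<sigma> (\<tau> u) = u" "\<tau> (\<sigma> u) = u" for u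
    unfolding \<tau>_def using permutes_inverses[OF perm] by auto
  have \<tau>im: "\<tau> u \<in> {1..n}" if "u \<in> {1..n}" for u
    using that permutes_in_image[OF perm, of "\<tau> u"] \<tau>(1)[of u] by simp
  define E where "E = ext n c"
  define X where "X k = x (\<tau> (window_res n k))" for k
  define Y where "Y k = y (\<tau> (window_res n k))" for k
  have Xd: "X s - X t = of_int (t - s) / real n + of_int (E t - E s)" for s t
    unfolding X_def E_def by (rule point_differences[OF n0 perm x \<tau>(1)])
  have main: "of_int (E t - E s) \<le> Y s - Y t" if "s < t" "t < s + int n" "X t < X s" for s t
    using that
  proof (induction "nat (t - s)" arbitrary: s t rule: less_induct)
    case less
    define f where "f = E t - E s"
    have frac: "0 < real_of_int (t - s) / real n" "real_of_int (t - s) / real n < 1"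
      using less.prems n0 by (simp_all add: field_simps)
    have "real_of_int f > - 1" using Xd[of s t] frac less.prems(3) unfolding f_def by linarith
    then have f0: "f \<ge> 0" by linarith
    show ?case
    proof (cases "f \<le> int m")
      case True
      let ?a = "\<tau> (window_res n s)" and ?b = "\<tau> (window_res n t)"
      have im: "?a \<in> {1..n}" "?b \<in> {1..n}" using \<tau>im window_res_range[OF n0] by blast+
      have lt: "x ?b < x ?a" using less.prems(3) by (simp add: X_def)
      have "\<not> ?b \<le> ?a"
      proof
        assume "?b \<le> ?a"
        then consider "?b = ?a" | "?b < ?a" by linarith
        then show False
        proof cases
          case 1
          then show False using lt by simp
        next
          case 2
          then show False using dom[of ?b ?a] im lt by (simp add: index_pairs_def)
        qed
      qed
      then have p: "(?a, ?b) \<in> index_pairs n" using im by (simp add: index_pairs_def)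
      have "f \<in> {- int m<..int m}" using True f0 m by simp
      then have "x ?a - x ?b < of_int f \<longleftrightarrow> y ?a - y ?b < of_int f"
        using same p unfolding same_side_def by blast
      moreover have "\<not> x ?a - x ?b < of_int f"
        using Xd[of s t] frac(1) unfolding X_def f_def by linarith
      ultimately show ?thesis unfolding Y_def f_def by linarith
    next
      case False
      have "\<exists>u. s < u \<and> u < t \<and> X u < X s \<and> X t < X u"
      proof (rule ccontr)
        assume none: "\<nexists>u. s < u \<and> u < t \<and> X u < X s \<and> X t < X u"
        have "\<exists>j. s \<le> j \<and> j < t \<and> X s \<le> X j \<and> X (j + 1) \<le> X t"
        proof (rule ccontr)
          assume nj: "\<nexists>j. s \<le> j \<and> j < t \<and> X s \<le> X j \<and> X (j + 1) \<le> X t"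
          have "j < t \<longrightarrow> X s \<le> X j" if "s \<le> j" for j
            using that
          proof (induction j rule: int_ge_induct)
            case (step i)
            show ?case
            proof
              assume "i + 1 < t"
              then have "X s \<le> X i" "\<not> X (i + 1) \<le> X t" using step nj by auto
              then show "X s \<le> X (i + 1)" using none \<open>i + 1 < t\<close> step(1)
                by (meson not_le zle_add1_eq_le)
            qed
          qed simp
          then have "X s \<le> X (t - 1)" using less.prems(1) by simp
          then show False using nj less.prems(1) by (metis diff_add_cancel diff_less_eq less_add_one order_refl zle_diff1_eq)
        qed
        then obtain j where j: "s \<le> j" "j < t" "X s \<le> X j" "X (j + 1) \<le> X t" by blast
        have "X s - X t \<le> X j - X (j + 1)" using j by simp
        moreover have "1 / real n \<le> real_of_int (t - s) / real n"
          using less.prems(1) by (intro divide_right_mono) simp_all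
        ultimately have "f \<le> E (j + 1) - E j"
          using Xd[of s t] Xd[of j "j + 1"] unfolding f_def by simp
        then show False using step[of j] False unfolding E_def by simp
      qed
      then obtain u where u: "s < u" "u < t" "X u < X s" "X t < X u" by blast
      have "of_int (E u - E s) \<le> Y s - Y u" using less.hyps[of u s] u less.prems by simp
      moreover have "of_int (E t - E u) \<le> Y u - Y t" using less.hyps[of t u] u less.prems by simp
      ultimately show ?thesis by simp
    qed
  qed
  have im: "a \<in> {1..n}" "b \<in> {1..n}" "a < b" using ab by (auto simp: index_pairs_def)
  have \<sigma>im: "\<sigma> a \<in> {1..n}" "\<sigma> b \<in> {1..n}" using im permutes_in_image[OF perm] by blast+
  have "\<sigma> a \<noteq> \<sigma> b" using im \<tau>(2) by (metis less_irrefl)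
  define s t where "s = int (\<sigma> a)" and "t = (if \<sigma> a < \<sigma> b then int (\<sigma> b) else int (\<sigma> b) + int n)"
  have st: "s < t" "t < s + int n" using \<sigma>im \<open>\<sigma> a \<noteq> \<sigma> b\<close> by (auto simp: s_def t_def)
  have w: "window_res n s = \<sigma> a" "window_res n t = \<sigma> b"
    using window_res_nat[OF \<sigma>im(1)] window_res_nat[OF \<sigma>im(2)] by (simp_all add: s_def t_def)
  have XY: "X s = x a" "X t = x b" "Y s = y a" "Y t = y b" by (simp_all add: X_def Y_def w \<tau>(2))
  have frac: "0 < real_of_int (t - s) / real n" "real_of_int (t - s) / real n < 1"
    using st n0 by (simp_all add: field_simps)
  have "\<lfloor>x a - x b\<rfloor> = E t - E s"
    using Xd[of s t] frac unfolding XY by (intro floor_unique) linarith+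
  moreover have "E t - E s \<le> \<lfloor>y a - y b\<rfloor>"
    using main[OF st] dom[OF ab] unfolding XY by (simp add: le_floor_iff)
  ultimately show ?thesis by simp
qed

text \<open>
  Modulo 1 the coordinates of the base point are evenly spaced, and the reflection exchanges two that
  are cyclically adjacent; no other pair changes its order.
\<close>
lemma neighbour_floor:
  assumes n: "n \<ge> 2" and i: "i < n" and u: "u \<in> {1..n}" "v \<in> {1..n}" "u < v"
    and ne: "{u, v} \<noteq> {if i = 0 then n else i, i + 1}"
  shows "\<lfloor>vec_refl n i (base_point n) u - vec_refl n i (base_point n) v\<rfloor> = 0"
proof -
  let ?q = "vec_refl n i (base_point n)"
  define e where "e = (if i = 0 then n else i)"
  define \<delta> :: "nat \<Rightarrow> int" where "\<delta> k = (if k = e then - 1 else if k = i + 1 then 1 else 0)" for k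
  have q: "?q k = (real n + 1) / (2 * real n) + (of_int (\<delta> k) - real k) / real n" if "k \<in> {1..n}" for k
    using that i n by (auto simp: vec_refl_def base_point_def \<delta>_def e_def field_simps)
  define z where "z = int v - int u + \<delta> u - \<delta> v"
  have "?q u - ?q v = of_int z / real n"
    unfolding q[OF u(1)] q[OF u(2)] z_def by (simp add: add_divide_distrib diff_divide_distrib)
  moreover have "0 \<le> z \<and> z < int n"
    using u ne i n unfolding z_def \<delta>_def e_def by (auto simp: doubleton_eq_iff split: if_splits)
  then have "0 \<le> real_of_int z / real n" "real_of_int z / real n < 1"
    using n by (simp_all add: field_simps)
  ultimately show ?thesis by (intro floor_unique) simp_all
qed

text \<open>
  The two alcoves differ only at their common wall, whose level exceeds \<open>m\<close>, so it is
  not a hyperplane of the arrangement.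
\<close>
lemma shorter_neighbour:
  assumes n: "n \<ge> 2" and i: "i < n" and m: "m \<ge> 1" and perm: "\<sigma> permutes {1..n}"
    and x: "x = (\<lambda>a. base_point n (\<sigma> a) - of_int (c (\<sigma> a)))"
    and x': "x' = (\<lambda>a. vec_refl n i (base_point n) (\<sigma> a) - of_int (c (\<sigma> a)))"
    and dom: "\<And>a b. (a, b) \<in> index_pairs n \<Longrightarrow> x b < x a"
    and step: "int m < ext n c (int i + 1) - ext n c (int i)"
  shows "same_side n {- int m<..int m} x x'" "separation n x' < separation n x"
proof -
  let ?p = "base_point n" and ?q = "vec_refl n i (base_point n)"
  have n0: "n > 0" using n by simp
  define e where "e = (if i = 0 then n else i)"
  define \<tau> where "\<tau> = inv_into UNIV \<sigma>"
  have \<tau>: "\<sigma> (\<tau> u) = u" "\<tau> (\<sigma> u) = u" for u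
    unfolding \<tau>_def using permutes_inverses[OF perm] by auto
  have \<tau>im: "\<tau> u \<in> {1..n}" if "u \<in> {1..n}" for u
    using that permutes_in_image[OF perm, of "\<tau> u"] \<tau>(1)[of u] by simp
  have e: "e \<in> {1..n}" "i + 1 \<in> {1..n}" "e \<noteq> i + 1" using n i by (auto simp: e_def)
  define a0 b0 where "a0 = \<tau> e" and "b0 = \<tau> (i + 1)"
  have \<sigma>0: "\<sigma> a0 = e" "\<sigma> b0 = i + 1" unfolding a0_def b0_def \<tau> by auto
  define d where "d = ext n c (int i + 1) - ext n c (int i)"
  have "window_res n (int i) = e"
  proof (cases "i = 0")
    case True
    have "(- 1) mod int n = int n - 1" using n by (simp add: zmod_minus1)
    then show ?thesis using True n by (simp add: window_res_def e_def)
  next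
    case False
    then show ?thesis using window_res_nat(1)[of i n] i by (simp add: e_def)
  qed
  moreover have "window_res n (int i + 1) = i + 1"
    using window_res_nat(1)[OF e(2)] by (simp add: add.commute)
  ultimately have d0: "x a0 - x b0 = 1 / real n + of_int d"
    using point_differences[OF n0 perm x \<tau>(1), of "int i" "int i + 1"]
    unfolding a0_def b0_def d_def by simp
  have inv_n: "0 < 1 / real n" "1 / real n < 1" using n by (simp_all add: field_simps)
  have dm: "real_of_int d \<ge> real m + 1" using step unfolding d_def by linarith
  then have "x b0 < x a0" using d0 inv_n by linarith
  then have "\<not> b0 \<le> a0" using dom[of b0 a0] \<tau>im e unfolding a0_def b0_def index_pairs_def
    by (metis (mono_tags, lifting) atLeastAtMost_iff case_prodI le_neq_implies_less less_asym less_irrefl mem_Collect_eq)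
  then have p0: "(a0, b0) \<in> index_pairs n"
    using \<tau>im e by (auto simp: a0_def b0_def index_pairs_def)
  have d0': "x' a0 - x' b0 = of_int d - 1 / real n"
  proof -
    have "?q e = ?p e - 1 / real n" "?q (i + 1) = ?p (i + 1) + 1 / real n"
      using n i by (auto simp: vec_refl_def base_point_def e_def field_simps)
    then have "x' a0 - x' b0 = x a0 - x b0 - 2 * (1 / real n)"
      unfolding x x' \<sigma>0 by simp
    then show ?thesis using d0 by simp
  qed
  have fl0: "\<lfloor>x a0 - x b0\<rfloor> = d" "\<lfloor>x' a0 - x' b0\<rfloor> = d - 1"
    unfolding d0 d0' using inv_n by (intro floor_unique; simp)+
  have regp: "regular n ?p" by (rule fundamental_regular[OF n base_point_fundamental[OF n]])
  have regq: "regular n ?q" using regular_foldr[OF n _ regp, of "[i]"] i by simp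
  have fl: "\<lfloor>x a - x b\<rfloor> = \<lfloor>x' a - x' b\<rfloor>" if ab: "(a, b) \<in> index_pairs n" "(a, b) \<noteq> (a0, b0)" for a b
  proof -
    have im: "a \<in> {1..n}" "b \<in> {1..n}" "a < b" using ab by (auto simp: index_pairs_def)
    have \<sigma>im: "\<sigma> a \<in> {1..n}" "\<sigma> b \<in> {1..n}" using im permutes_in_image[OF perm] by blast+
    have ne: "\<sigma> a \<noteq> \<sigma> b" using im \<tau>(2) by (metis less_irrefl)
    have n1: "{\<sigma> a, \<sigma> b} \<noteq> {e, i + 1}"
    proof
      assume "{\<sigma> a, \<sigma> b} = {e, i + 1}"
      then have "\<sigma> a = e \<and> \<sigma> b = i + 1 \<or> \<sigma> a = i + 1 \<and> \<sigma> b = e"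
        unfolding doubleton_eq_iff .
      then have "a = a0 \<and> b = b0 \<or> a = b0 \<and> b = a0" unfolding a0_def b0_def using \<tau>(2) by metis
      then show False using ab(2) im(3) \<open>\<not> b0 \<le> a0\<close> by auto
    qed
    have p: "\<lfloor>?p u - ?p v\<rfloor> = 0" if "u \<in> {1..n}" "v \<in> {1..n}" "u < v" for u v
    proof -
      have "?p v < ?p u \<and> ?p u < ?p v + 1"
        using base_point_fundamental[OF n] that unfolding fundamental_alcove_iff[OF n] by simp
      then show ?thesis by linarith
    qed
    note q = neighbour_floor[OF n i, folded e_def]
    have "\<lfloor>?p (\<sigma> a) - ?p (\<sigma> b)\<rfloor> = \<lfloor>?q (\<sigma> a) - ?q (\<sigma> b)\<rfloor>"
    proof (cases "\<sigma> a < \<sigma> b")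
      case True
      then show ?thesis using p[OF \<sigma>im True] q[OF \<sigma>im True n1] by simp
    next
      case False
      then have lt: "\<sigma> b < \<sigma> a" using ne by simp
      have n2: "{\<sigma> b, \<sigma> a} \<noteq> {e, i + 1}" using n1 by (simp add: insert_commute)
      show ?thesis
        using p[OF \<sigma>im(2,1) lt] q[OF \<sigma>im(2,1) lt n2]
          floor_swap[OF regp \<sigma>im(2,1)] floor_swap[OF regq \<sigma>im(2,1)] ne by simp
    qed
    moreover have "\<lfloor>x a - x b\<rfloor> = \<lfloor>?p (\<sigma> a) - ?p (\<sigma> b)\<rfloor> + (c (\<sigma> b) - c (\<sigma> a))"
    proof -
      have "x a - x b = ?p (\<sigma> a) - ?p (\<sigma> b) + of_int (c (\<sigma> b) - c (\<sigma> a))" unfolding x by simp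
      then show ?thesis by (simp only: floor_add_int)
    qed
    moreover have "\<lfloor>x' a - x' b\<rfloor> = \<lfloor>?q (\<sigma> a) - ?q (\<sigma> b)\<rfloor> + (c (\<sigma> b) - c (\<sigma> a))"
    proof -
      have "x' a - x' b = ?q (\<sigma> a) - ?q (\<sigma> b) + of_int (c (\<sigma> b) - c (\<sigma> a))" unfolding x' by simp
      then show ?thesis by (simp only: floor_add_int)
    qed
    ultimately show ?thesis by simp
  qed
  have "x a - x b < of_int k \<longleftrightarrow> x' a - x' b < of_int k"
    if "(a, b) \<in> index_pairs n" "k \<in> {- int m<..int m}" for a b k
  proof (cases "(a, b) = (a0, b0)")
    case True
    have "real_of_int k \<le> real m" using that(2) by simp
    then have "\<not> x a0 - x b0 < of_int k" "\<not> x' a0 - x' b0 < of_int k"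
      using d0 d0' dm inv_n by linarith+
    then show ?thesis using True by simp
  next
    case False
    then show ?thesis
      using fl[OF that(1) False] floor_less_iff[of "x a - x b" k] floor_less_iff[of "x' a - x' b" k] by simp
  qed
  then show "same_side n {- int m<..int m} x x'" unfolding same_side_def by blast
  show "separation n x' < separation n x"
    unfolding separation_def
  proof (rule sum_strict_mono_ex1[OF finite_index_pairs])
    have d1: "d \<ge> 1" using dm by linarith
    show "\<forall>q\<in>index_pairs n. (case q of (a, b) \<Rightarrow> nat \<bar>\<lfloor>x' a - x' b\<rfloor>\<bar>) \<le> (case q of (a, b) \<Rightarrow> nat \<bar>\<lfloor>x a - x b\<rfloor>\<bar>)"
    proof
      fix q assume q: "q \<in> index_pairs n"
      obtain a b where ab: "q = (a, b)" by (cases q)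
      show "(case q of (a, b) \<Rightarrow> nat \<bar>\<lfloor>x' a - x' b\<rfloor>\<bar>) \<le> (case q of (a, b) \<Rightarrow> nat \<bar>\<lfloor>x a - x b\<rfloor>\<bar>)"
        using fl[of a b] q fl0 d1 unfolding ab by (cases "(a, b) = (a0, b0)") auto
    qed
    show "\<exists>q\<in>index_pairs n. (case q of (a, b) \<Rightarrow> nat \<bar>\<lfloor>x' a - x' b\<rfloor>\<bar>) < (case q of (a, b) \<Rightarrow> nat \<bar>\<lfloor>x a - x b\<rfloor>\<bar>)"
      by (rule bexI[OF _ p0]) (use fl0 d1 in simp)
  qed
qed

section \<open>Minimal coset representatives and the theorem\<close>

lemma word_eq_rev:
  assumes "word_eq n xs ys" shows "word_eq n (rev xs) (rev ys)"
  using assms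
proof (induction rule: word_eq.induct)
  case (word_refl xs)
  then show ?case by (intro word_eq.word_refl rev_in_lists)
next
  case (word_step xs ys us vs)
  have ctx: "rev vs \<in> lists {..<n}" "rev us \<in> lists {..<n}" using word_step(2,3) by (simp_all add: in_lists_conv_set)
  have "coxeter_relation n (rev xs) (rev ys) \<or> coxeter_relation n (rev ys) (rev xs)"
    using word_step(1)
  proof cases
    case (square i)
    then show ?thesis using coxeter_relation.square[of i n] by simp
  next
    case (commute i j)
    then show ?thesis using word_step(1) by simp
  next
    case (braid i j)
    then show ?thesis using word_step(1) by simp
  qed
  then have "word_eq n (rev vs @ rev xs @ rev us) (rev vs @ rev ys @ rev us)"
    using word_eq.word_step[OF _ ctx] word_sym by blast
  then show ?case by simp
qed (auto intro: word_sym word_trans)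

lemma inv_class:
  assumes xs: "xs \<in> lists {..<n}"
  shows "inv\<^bsub>affine_sym n\<^esub> (word_rel n `` {xs}) = word_rel n `` {rev xs}"
proof (rule group.inv_equality[OF group_affine_sym])
  have "\<one>\<^bsub>affine_sym n\<^esub> = word_rel n `` {[]}" by (simp add: affine_sym_def)
  then show "word_rel n `` {rev xs} \<otimes>\<^bsub>affine_sym n\<^esub> word_rel n `` {xs} = \<one>\<^bsub>affine_sym n\<^esub>"
    using affine_sym_mult_class[OF rev_in_lists[OF xs] xs] class_eq[OF word_eq_rev_append[OF xs]] by simp
  show "word_rel n `` {xs} \<in> carrier (affine_sym n)" by (rule class_in_carrier[OF xs])
  show "word_rel n `` {rev xs} \<in> carrier (affine_sym n)"
    by (rule class_in_carrier[OF rev_in_lists[OF xs]])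
qed

text \<open>
  A wall of the dominant chamber that separates the point from it would allow splitting off the last letter
  of a shortest word of \<open>w\<close>, giving a shorter element of the same coset.
\<close>
lemma min_rep_dominant:
  assumes n: "n \<ge> 2" and min: "min_left_coset_rep n w"
    and xs: "xs \<in> lists {..<n}" "w = word_rel n `` {xs}" "length xs = cox_length w"
    and p: "p \<in> fundamental_alcove n" and ab: "(a, b) \<in> index_pairs n"
  shows "foldr (vec_refl n) (rev xs) p b < foldr (vec_refl n) (rev xs) p a"
proof -
  let ?x = "foldr (vec_refl n) (rev xs) p"
  have rxs: "rev xs \<in> lists {..<n}" by (rule rev_in_lists[OF xs(1)])
  have reg: "regular n ?x" by (rule regular_foldr[OF n rxs fundamental_regular[OF n p]])
  have simple: "?x (i + 1) \<le> ?x i" if i: "1 \<le> i" "i < n" for i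
  proof (rule ccontr)
    assume "\<not> ?thesis"
    then have "ext n ?x (int i) < ext n ?x (int i + 1)"
      using ext_nat[of i n ?x] ext_nat[of "i + 1" n ?x] i by (simp add: add.commute)
    then obtain ys where ys: "word_eq n (rev xs) (i # ys)" "length ys < length xs"
      using exchange[OF n fundamental_ascents[OF n p] rxs, of "int i"] letter_nat[OF i(2)] by auto
    have ysl: "ys \<in> lists {..<n}" using word_eq_lists[OF ys(1)] by simp
    have "word_eq n xs (rev ys @ [i])" using word_eq_rev[OF ys(1)] by simp
    then have "word_eq n (xs @ [i]) (rev ys @ [i, i])"
      using word_eq_append_right[of n xs "rev ys @ [i]" "[i]"] i by simp
    moreover have "word_eq n (rev ys @ [i, i]) (rev ys)"
      using word_step[OF square[OF i(2)] rev_in_lists[OF ysl], of "[]"] by simp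
    ultimately have "word_rel n `` {xs @ [i]} = word_rel n `` {rev ys}"
      using word_trans class_eq by blast
    then have prod: "w \<otimes>\<^bsub>affine_sym n\<^esub> sgen n i = word_rel n `` {rev ys}"
      using affine_sym_mult_class[OF xs(1), of "[i]"] i xs(2) by (simp add: sgen_def)
    have "sgen n i \<in> finite_sym n" unfolding finite_sym_def using i by (intro generate.incl) simp
    then have "word_rel n `` {rev ys} \<in> w <#\<^bsub>affine_sym n\<^esub> finite_sym n"
      unfolding l_coset_def using prod by blast
    moreover have "cox_length (word_rel n `` {rev ys}) < cox_length w"
      using cox_length_le[of "rev ys" "word_rel n `` {rev ys}"] word_refl[OF rev_in_lists[OF ysl]] ys(2) xs(3)
      by (simp add: word_rel_def)
    ultimately show False using min unfolding min_left_coset_rep_def is_arg_min_def by blast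
  qed
  have a: "1 \<le> a" "a < b" "b \<le> n" using ab by (auto simp: index_pairs_def)
  have "?x b \<le> ?x a" using less_imp_le[OF a(2)] a(1,3)
  proof (induction b rule: dec_induct)
    case (step k)
    then show ?case using simple[of k] by simp
  qed simp
  moreover have "?x a - ?x b \<notin> \<int>" using reg a unfolding regular_def by auto
  then have "?x a \<noteq> ?x b" by auto
  ultimately show ?thesis by simp
qed

theorem mainTheorem3:
  fixes n m :: nat and lam :: diagram and w :: "nat list set" and A :: "vec set"
  assumes "n \<ge> 2" and "m \<ge> 1"
    and "is_core n lam"
    and "min_left_coset_rep n w"
    and "word_act (core_refl n) w {} = lam"
    and "A = alcove_of n (inv\<^bsub>affine_sym n\<^esub> w)"
  shows "(m_minimal n m A \<longleftrightarrow>
            (\<forall>i\<in>{0..<int n}. \<forall>k. card (removable_boxes n lam i) = k \<longrightarrow> k \<le> m)) \<and>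
         (m_minimal n m A \<longrightarrow> is_core (m * n + 1) lam)"
proof -
  note n = assms(1) and m = assms(2)
  have n0: "n > 0" using n by simp
  have "w \<in> carrier (affine_sym n)" using assms(4) by (simp add: min_left_coset_rep_def)
  then obtain xs where xs: "xs \<in> lists {..<n}" "w = word_rel n `` {xs}" "length xs = cox_length w"
    by (rule shortest_word)
  have rxs: "rev xs \<in> lists {..<n}" by (rule rev_in_lists[OF xs(1)])
  obtain c :: "nat \<Rightarrow> int" and \<pi> where \<pi>: "\<pi> permutes {1..n}"
    and wp: "\<And>p. foldr (vec_refl n) xs p = (\<lambda>a. p (\<pi> a) + of_int (c a))"
    using word_affine[OF n xs(1)] by blast
  define \<sigma> where "\<sigma> = inv_into UNIV \<pi>"
  have \<sigma>: "\<sigma> permutes {1..n}" unfolding \<sigma>_def by (rule permutes_inv[OF \<pi>])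
  have wr: "foldr (vec_refl n) (rev xs) p = (\<lambda>a. p (\<sigma> a) - of_int (c (\<sigma> a)))" for p
    unfolding \<sigma>_def by (rule word_affine_rev[OF n xs(1) \<pi> wp])
  let ?p = "base_point n" and ?K = "{- int m<..int m}"
  have p: "?p \<in> fundamental_alcove n" by (rule base_point_fundamental[OF n])
  have ph: "?p \<in> hyperspace n" using p by (simp add: fundamental_alcove_def)
  define x where "x = foldr (vec_refl n) (rev xs) ?p"
  have x: "x = (\<lambda>a. ?p (\<sigma> a) - of_int (c (\<sigma> a)))" unfolding x_def wr ..
  have dom: "x b < x a" if "(a, b) \<in> index_pairs n" for a b
    unfolding x_def by (rule min_rep_dominant[OF n assms(4) xs p that])
  have comp: "foldr (vec_refl n) ys ?p \<in> arr_complement n K" if "ys \<in> lists {..<n}" for ys K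
    by (intro regular_arr_complement foldr_hyperspace regular_foldr n that ph fundamental_regular p)
  have A: "A = foldr (vec_refl n) (rev xs) ` fundamental_alcove n"
    unfolding assms(6) xs(2) inv_class[OF xs(1)] by (rule alcove_of_word[OF n rxs])
  have carrier_alcove: "alcove_of n u \<subseteq> R \<longleftrightarrow> foldr (vec_refl n) ys ?p \<in> R"
    if "ys \<in> lists {..<n}" "u = word_rel n `` {ys}" "R \<in> shi_regions n m" for u ys R
    unfolding that(2) alcove_of_word[OF n that(1)] by (rule alcove_subset_region[OF n that(1) p that(3)])
  define d where "d k = ext n c (k + 1) - ext n c k" for k
  obtain \<rho> where \<rho>: "partition_rows \<rho>" "foldr (core_refl n) xs {} = diag \<rho>"
    "range (bead \<rho>) = {k. 0 < ext n (foldr (vec_refl n) xs (\<lambda>_. 0)) k}"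
    using core_of_word[OF n xs(1)] by blast
  have lam: "lam = diag \<rho>"
    using assms(5) core_of_class[OF n xs(1)] \<rho>(2) unfolding xs(2) by simp
  have beads: "range (bead \<rho>) = {k. 0 < ext n c k}"
    unfolding \<rho>(3) wp by (simp add: ext_of_int)
  have card: "card (removable_boxes n lam (int i)) = nat (d (int i))" if "i < n" for i
    unfolding lam d_def by (rule card_removable[OF n0 \<rho>(1) that beads])
  have cond_iff: "(\<forall>i\<in>{0..<int n}. \<forall>k. card (removable_boxes n lam i) = k \<longrightarrow> k \<le> m) \<longleftrightarrow>
      (\<forall>i<n. d (int i) \<le> int m)"
  proof -
    have "{0..<int n} = int ` {..<n}" by (simp add: image_int_atLeastLessThan lessThan_atLeast0)
    then have "(\<forall>i\<in>{0..<int n}. card (removable_boxes n lam i) \<le> m) \<longleftrightarrow>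
      (\<forall>i<n. card (removable_boxes n lam (int i)) \<le> m)"
      by auto
    then show ?thesis using card by (simp add: nat_le_iff)
  qed
  have d_all: "d k \<le> int m" if "\<forall>i<n. d (int i) \<le> int m" for k
  proof -
    have k: "k = int (nat (k mod int n)) + int n * (k div int n)" using n0 by simp
    have "d (l + int n * t) = d l" for l t
      using ext_shift[OF n0, of c "l" t] ext_shift[OF n0, of c "l + 1" t]
      unfolding d_def by (simp add: algebra_simps)
    then have "d k = d (int (nat (k mod int n)))" using k by metis
    moreover have "nat (k mod int n) < n" using n0 by (simp add: nat_less_iff)
    ultimately show ?thesis using that by metis
  qed
  have sufficient: "m_minimal n m A" if "\<forall>i<n. d (int i) \<le> int m"
    unfolding m_minimal_def
  proof (intro conjI)
    show "A \<in> alcoves n" unfolding A by (rule alcove_in_alcoves[OF n rxs p])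
    define R where "R = {y \<in> arr_complement n ?K. same_side n ?K x y}"
    have R: "R \<in> shi_regions n m"
      unfolding R_def shi_regions_eq using comp[OF rxs] unfolding x_def by blast
    have xR: "x \<in> R" unfolding R_def using comp[OF rxs] by (simp add: x_def same_side_def)
    let ?u = "word_rel n `` {rev xs}"
    have "is_arg_min cox_length (\<lambda>u. u \<in> carrier (affine_sym n) \<and> alcove_of n u \<subseteq> R) ?u"
      unfolding is_arg_min_linorder
    proof (intro conjI allI impI)
      show "?u \<in> carrier (affine_sym n)" by (rule class_in_carrier[OF rxs])
      show "alcove_of n ?u \<subseteq> R" using carrier_alcove[OF rxs refl R] xR by (simp add: x_def)
      fix u assume u: "u \<in> carrier (affine_sym n) \<and> alcove_of n u \<subseteq> R"
      then obtain ys where ys: "ys \<in> lists {..<n}" "u = word_rel n `` {ys}" by (blast elim: carrierE)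
      define y where "y = foldr (vec_refl n) ys ?p"
      have "y \<in> R" using carrier_alcove[OF ys R] u by (simp add: y_def)
      then have same: "same_side n ?K x y" by (simp add: R_def)
      have "separation n x \<le> separation n y"
        unfolding separation_def
      proof (rule sum_mono)
        fix q assume q: "q \<in> index_pairs n"
        obtain a b where ab: "q = (a, b)" by (cases q)
        have "\<lfloor>x a - x b\<rfloor> \<le> \<lfloor>y a - y b\<rfloor>"
          using dominant_floor_le[OF n m \<sigma> x dom _ same] d_all[OF that] q
          unfolding d_def ab by blast
        moreover have "0 \<le> \<lfloor>x a - x b\<rfloor>" using dom[of a b] q ab by simp
        ultimately show "(case q of (a, b) \<Rightarrow> nat \<bar>\<lfloor>x a - x b\<rfloor>\<bar>) \<le> (case q of (a, b) \<Rightarrow> nat \<bar>\<lfloor>y a - y b\<rfloor>\<bar>)"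
          unfolding ab by simp
      qed
      then show "cox_length ?u \<le> cox_length u"
        unfolding ys(2) cox_length_separation[OF n p rxs] cox_length_separation[OF n p ys(1)]
        by (simp add: x_def y_def)
    qed
    moreover have "A = alcove_of n ?u" unfolding A alcove_of_word[OF n rxs] ..
    ultimately show "\<exists>R\<in>shi_regions n m. \<exists>w. A = alcove_of n w \<and>
        is_arg_min cox_length (\<lambda>u. u \<in> carrier (affine_sym n) \<and> alcove_of n u \<subseteq> R) w"
      using R by blast
  qed
  have necessary: "\<forall>i<n. d (int i) \<le> int m" if minimal: "m_minimal n m A"
  proof (rule ccontr)
    assume "\<not> ?thesis"
    then obtain i where i: "i < n" "int m < d (int i)" by force
    obtain R u where R: "R \<in> shi_regions n m" and Au: "A = alcove_of n u"
      and min: "is_arg_min cox_length (\<lambda>u. u \<in> carrier (affine_sym n) \<and> alcove_of n u \<subseteq> R) u"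
      using minimal unfolding m_minimal_def by blast
    have u: "u \<in> carrier (affine_sym n)" "alcove_of n u \<subseteq> R" using min by (auto simp: is_arg_min_def)
    obtain ys where ys: "ys \<in> lists {..<n}" "u = word_rel n `` {ys}" using u(1) by (rule carrierE)
    \<comment> \<open>The element \<open>u\<close> is only known to have the same alcove as the inverse of \<open>w\<close>; this fixes its length.\<close>
    define y where "y = foldr (vec_refl n) ys ?p"
    have "y \<in> A" using p unfolding Au ys(2) alcove_of_word[OF n ys(1)] y_def by blast
    then have "same_side n UNIV x y" unfolding A alcove_points[OF n rxs p] x_def by blast
    then have "separation n x = separation n y"
      unfolding same_side_UNIV separation_def by (intro sum.cong) auto
    then have len_u: "cox_length u = separation n x"
      unfolding ys(2) cox_length_separation[OF n p ys(1)] y_def by simp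
    let ?zs = "rev xs @ [i]"
    have zs: "?zs \<in> lists {..<n}" using rxs i(1) by simp
    define x' where "x' = foldr (vec_refl n) ?zs ?p"
    have x': "x' = (\<lambda>a. vec_refl n i ?p (\<sigma> a) - of_int (c (\<sigma> a)))"
      unfolding x'_def foldr_append wr by simp
    note nb = shorter_neighbour[OF n i(1) m \<sigma> x x' dom i(2)[unfolded d_def]]
    have "x \<in> R" using u(2) p unfolding Au[symmetric] A x_def by blast
    moreover obtain z where "R = {y \<in> arr_complement n ?K. same_side n ?K z y}"
      using R unfolding shi_regions_eq by blast
    moreover have "x' \<in> arr_complement n ?K" unfolding x'_def by (rule comp[OF zs])
    ultimately have "x' \<in> R" using nb(1) unfolding same_side_def by fast
    then have "alcove_of n (word_rel n `` {?zs}) \<subseteq> R"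
      using carrier_alcove[OF zs refl R] by (simp add: x'_def)
    then have "cox_length u \<le> cox_length (word_rel n `` {?zs})"
      using min class_in_carrier[OF zs] unfolding is_arg_min_linorder by blast
    then show False
      using nb(2) unfolding len_u cox_length_separation[OF n p zs] x'_def by simp
  qed
  have core: "is_core (m * n + 1) lam" if "\<forall>i<n. d (int i) \<le> int m"
    unfolding lam
  proof (rule core_of_bead_shift[OF \<rho>(1)])
    fix k assume k: "k \<in> range (bead \<rho>)"
    have eq: "k - int (m * n + 1) = (k - 1) + int n * (- int m)" by (simp add: algebra_simps)
    have "ext n c (k - int (m * n + 1)) = ext n c (k - 1) + int m"
      using ext_shift[OF n0, of c "k - 1" "- int m"] unfolding eq by simp
    moreover have "0 < ext n c k" using k unfolding beads by simp
    moreover have "d (k - 1) \<le> int m" by (rule d_all[OF that])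
    ultimately show "k - int (m * n + 1) \<in> range (bead \<rho>)" unfolding beads d_def by simp
  qed simp
  show ?thesis unfolding cond_iff using sufficient necessary core by blast
qed

end
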